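(* For each $\varepsilon>0$ and $v_0\ge0$ there exist constants $A,B>0$ such that for all $n\ge1$ and all $v\in[0,v_0]$, \[\mathbb P\big(T((0,0),(n,\lceil vn\rceil))\ge n(\Lambda(v)+\varepsilon)\big)\le A\exp(-Bn).\]
   Context: Model: Let $G$ be any probability measure on $[0,\infty)$. In $\mathbb Z^2$, every vertical edge has weight $1$ and every horizontal edge an independent random weight with law $G$; the passage time of a nearest-neighbour path is the sum of its edge weights; $T(u,w)$ is the infimum over paths from $u$ to $w$. For $v\ge0$, $\Lambda(v)=\lim_n\frac1nT((0,0),(n,\lceil vn\rceil))$ (a.s. limit, deterministic). *)

theory Defs
  imports "HOL-Probability.Probability"
begin

text \<open>Lattice points of Z^2 are pairs of integers. The horizontal edge from (x,y) to (x+1,y)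
  is indexed by its left endpoint (x,y). An environment omega assigns a weight to every
  horizontal edge; vertical edges have weight 1.\<close>

type_synonym point = "int \<times> int"
type_synonym env = "point \<Rightarrow> real"

definition adjacent :: "point \<Rightarrow> point \<Rightarrow> bool" where
  "adjacent a b \<longleftrightarrow>
     (fst a = fst b \<and> \<bar>snd a - snd b\<bar> = 1) \<or> (snd a = snd b \<and> \<bar>fst a - fst b\<bar> = 1)"

definition edge_weight :: "env \<Rightarrow> point \<Rightarrow> point \<Rightarrow> real" where
  "edge_weight \<omega> a b = (if fst a = fst b then 1 else \<omega> (min (fst a) (fst b), snd a))"

definition is_path :: "point list \<Rightarrow> point \<Rightarrow> point \<Rightarrow> bool" where
  "is_path p u w \<longleftrightarrow> p \<noteq> [] \<and> hd p = u \<and> last p = w \<and>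
     (\<forall>i < length p - 1. adjacent (p ! i) (p ! Suc i))"

definition path_time :: "env \<Rightarrow> point list \<Rightarrow> real" where
  "path_time \<omega> p = (\<Sum>i < length p - 1. edge_weight \<omega> (p ! i) (p ! Suc i))"

definition passage_time :: "env \<Rightarrow> point \<Rightarrow> point \<Rightarrow> real" where
  "passage_time \<omega> u w = Inf {path_time \<omega> p | p. is_path p u w}"

definition fpp_space :: "real measure \<Rightarrow> env measure" where
  "fpp_space G = PiM UNIV (\<lambda>_::point. G)"

definition time_const :: "real measure \<Rightarrow> real \<Rightarrow> real" where
  "time_const G v = (THE l. AE \<omega> in fpp_space G.
      (\<lambda>n. passage_time \<omega> (0,0) (int n, \<lceil>v * real n\<rceil>) / real n) \<longlonglongrightarrow> l)"

end

theory Submission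
  imports Defs
begin

text \<open>Since vertical edges cost exactly 1, replacing a stretch of a path that returns to the same
  vertical line by a vertical segment never costs more. Hence optimal paths cross each column of
  horizontal edges once, and the passage time is a function of \<open>n\<close> independent columns. Resampling
  one column changes it, relative to making that column free, by at most the cost of stepping aside
  to a cheap edge near a row determined by the other columns; this cost has exponential moments
  for every \<open>G\<close>. Revealing the columns one at a time therefore bounds the exponential moments of
  the centred passage time by \<open>exp (K n \<theta>\<^sup>2)\<close> for \<open>\<bar>\<theta>\<bar> \<le> 1\<close>, so deviations of order \<open>n\<close> from the
  mean are exponentially unlikely, uniformly in \<open>v\<close>. The mean divided by \<open>n\<close> converges by
  subadditivity, uniformly on compacts because it is asymptotically 1-Lipschitz in \<open>v\<close>. Concentration
  and the Borel--Cantelli lemma identify its limit with the almost sure limit \<open>time_const\<close>.\<close>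

section \<open>Directed passage times\<close>

text \<open>The recursion picks the row in which the last column is crossed. Truncation by
  \<open>max 0\<close> keeps all the infima bounded below for every real environment, so that
  nonnegative weights need only be assumed when comparing with \<open>passage_time\<close>. Columns
  are separate arguments because they serve as the independent variables.\<close>

fun directed_time :: "nat \<Rightarrow> (nat \<Rightarrow> int \<Rightarrow> real) \<Rightarrow> int \<Rightarrow> real" where
  "directed_time 0 C y = \<bar>real_of_int y\<bar>"
| "directed_time (Suc n) C y =
     (INF z. directed_time n C z + max 0 (C n z) + \<bar>real_of_int (z - y)\<bar>)"

declare directed_time.simps(2) [simp del]

definition columns :: "env \<Rightarrow> nat \<Rightarrow> int \<Rightarrow> real" where
  "columns \<omega> k y = \<omega> (int k, y)"

lemma directed_time_nonneg: "0 \<le> directed_time n C y"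
proof (induction n arbitrary: y)
  case (Suc n)
  then show ?case unfolding directed_time.simps by (auto intro!: cINF_greatest add_nonneg_nonneg)
qed simp

lemma bdd_below_directed_step:
  "bdd_below (range (\<lambda>z. directed_time n C z + max 0 (D z) + \<bar>real_of_int (z - y)\<bar>))"
  by (rule bdd_belowI[of _ 0]) (auto intro!: add_nonneg_nonneg directed_time_nonneg)

lemma directed_time_Suc_le:
  "directed_time (Suc n) C y \<le> directed_time n C z + max 0 (C n z) + \<bar>real_of_int (z - y)\<bar>"
  unfolding directed_time.simps by (rule cINF_lower[OF bdd_below_directed_step]) simp

lemma directed_time_Suc_greatest:
  assumes "\<And>z. x \<le> directed_time n C z + max 0 (C n z) + \<bar>real_of_int (z - y)\<bar>"
  shows "x \<le> directed_time (Suc n) C y"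
  unfolding directed_time.simps by (rule cINF_greatest) (use assms in auto)

lemma directed_time_Suc_approx:
  assumes "\<delta> > 0"
  obtains z where "directed_time n C z + max 0 (C n z) + \<bar>real_of_int (z - y)\<bar>
    < directed_time (Suc n) C y + \<delta>"
proof -
  have "\<exists>z. directed_time n C z + max 0 (C n z) + \<bar>real_of_int (z - y)\<bar>
    < directed_time (Suc n) C y + \<delta>"
  proof (rule ccontr)
    assume "\<nexists>z. directed_time n C z + max 0 (C n z) + \<bar>real_of_int (z - y)\<bar>
      < directed_time (Suc n) C y + \<delta>"
    then have "directed_time (Suc n) C y + \<delta> \<le> directed_time (Suc n) C y"
      by (intro directed_time_Suc_greatest) (auto simp: not_less)
    then show False using assms by simp
  qed
  then show ?thesis using that by blast
qed

text \<open>Only the last vertical stretch is altered: the triangle inequality applies for each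
  crossing row \<open>z\<close>, so no induction is required.\<close>

lemma directed_time_lipschitz:
  "directed_time n C y \<le> directed_time n C y' + \<bar>real_of_int (y - y')\<bar>"
proof (cases n)
  case (Suc k)
  have "directed_time (Suc k) C y - \<bar>real_of_int (y - y')\<bar> \<le> directed_time (Suc k) C y'"
  proof (rule directed_time_Suc_greatest)
    fix z
    have "directed_time (Suc k) C y \<le> directed_time k C z + max 0 (C k z) + \<bar>real_of_int (z - y)\<bar>"
      by (rule directed_time_Suc_le)
    then show "directed_time (Suc k) C y - \<bar>real_of_int (y - y')\<bar>
      \<le> directed_time k C z + max 0 (C k z) + \<bar>real_of_int (z - y')\<bar>" by linarith
  qed
  then show ?thesis unfolding Suc by linarith
qed auto

lemma directed_time_le_Suc: "directed_time n C y \<le> directed_time (Suc n) C y"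
proof (rule directed_time_Suc_greatest)
  fix z show "directed_time n C y \<le> directed_time n C z + max 0 (C n z) + \<bar>real_of_int (z - y)\<bar>"
    using directed_time_lipschitz[of n C y z] by linarith
qed

lemma directed_time_Suc_zero:
  assumes "C n = (\<lambda>_. 0)"
  shows "directed_time (Suc n) C y = directed_time n C y"
  using directed_time_Suc_le[of n C y y] directed_time_le_Suc[of n C y] assms by simp

text \<open>Comparing truncated weights makes the zero column minimal among all columns; this is
  what later qualifies it as the baseline for resampling.\<close>

lemma directed_time_mono:
  assumes "\<And>k z. k < n \<Longrightarrow> max 0 (C k z) \<le> max 0 (C' k z)"
  shows "directed_time n C y \<le> directed_time n C' y"
  using assms
proof (induction n arbitrary: y)
  case (Suc n)
  show ?case
  proof (rule directed_time_Suc_greatest)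
    fix z
    have "directed_time n C z \<le> directed_time n C' z" "max 0 (C n z) \<le> max 0 (C' n z)"
      using Suc by auto
    then show "directed_time (Suc n) C y
      \<le> directed_time n C' z + max 0 (C' n z) + \<bar>real_of_int (z - y)\<bar>"
      using directed_time_Suc_le[of n C y z] by linarith
  qed
qed simp

lemma directed_time_cong:
  assumes "\<And>k. k < n \<Longrightarrow> C k = C' k"
  shows "directed_time n C y = directed_time n C' y"
  using assms by (intro antisym directed_time_mono) auto

text \<open>The row \<open>y\<close> is where a nearly optimal path crosses column \<open>k\<close> when this column is free of
  charge; a path may instead step aside to row \<open>z\<close> and back, at cost \<open>2 * \<bar>z - y\<bar>\<close>. It matters
  that \<open>y\<close> is chosen before the weights \<open>c\<close> of column \<open>k\<close>.\<close>

lemma directed_time_update_le: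
  assumes "k < n" "\<delta> > 0"
  shows "\<exists>y. \<forall>c z. directed_time n (C(k := c)) m
    \<le> directed_time n (C(k := (\<lambda>_. 0))) m + \<delta> + 2 * \<bar>real_of_int (z - y)\<bar> + max 0 (c z)"
  using assms
proof (induction n arbitrary: m \<delta>)
  case (Suc n)
  show ?case
  proof (cases "k = n")
    case True
    \<comment> \<open>If the free column is the last one, row \<open>m\<close> itself is optimal.
      The factor 2 arises once from moving to row \<open>z\<close> before the crossing (Lipschitz
      bound) and once from returning after it.\<close>
    have "directed_time (Suc n) (C(k := c)) m \<le> directed_time (Suc n) (C(k := (\<lambda>_. 0))) m
      + 2 * \<bar>real_of_int (z - m)\<bar> + max 0 (c z)" for c z
    proof -
      have eq: "directed_time n (C(k := d)) y = directed_time n C y" for d y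
        using True by (intro directed_time_cong) auto
      have "directed_time (Suc n) (C(k := (\<lambda>_. 0))) m = directed_time n C m"
        using True directed_time_Suc_zero[of "C(k := (\<lambda>_. 0))" n m] eq[of "\<lambda>_. 0" m] by simp
      moreover have "directed_time (Suc n) (C(k := c)) m
        \<le> directed_time n C z + max 0 (c z) + \<bar>real_of_int (z - m)\<bar>"
        using directed_time_Suc_le[of n "C(k := c)" m z] True unfolding eq by simp
      ultimately show ?thesis using directed_time_lipschitz[of n C z m] by (smt (verit))
    qed
    then show ?thesis using Suc.prems(2) by (intro exI[of _ m]) (smt (verit))
  next
    case False
    let ?C0 = "C(k := (\<lambda>_. 0))"
    have k: "k < n" "\<delta> / 2 > 0" using Suc.prems False by auto
    \<comment> \<open>Half of \<open>\<delta>\<close> pays for a nearly optimal last crossing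
      \<open>x\<close>, half goes to the induction hypothesis. Since \<open>x\<close> depends on
      \<open>?C0\<close> only, it is chosen before \<open>c\<close>.\<close>
    obtain x where x: "directed_time n ?C0 x + max 0 (?C0 n x) + \<bar>real_of_int (x - m)\<bar>
      < directed_time (Suc n) ?C0 m + \<delta> / 2"
      using directed_time_Suc_approx k(2) by blast
    obtain y where y: "\<And>c z. directed_time n (C(k := c)) x
      \<le> directed_time n ?C0 x + \<delta> / 2 + 2 * \<bar>real_of_int (z - y)\<bar> + max 0 (c z)"
      using Suc.IH[OF k, of x] by blast
    have "directed_time (Suc n) (C(k := c)) m \<le> directed_time (Suc n) ?C0 m + \<delta>
      + 2 * \<bar>real_of_int (z - y)\<bar> + max 0 (c z)" for c z
    proof -
      have "directed_time (Suc n) (C(k := c)) m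
        \<le> directed_time n (C(k := c)) x + max 0 (C n x) + \<bar>real_of_int (x - m)\<bar>"
        using directed_time_Suc_le[of n "C(k := c)" m x] False by simp
      moreover have "?C0 n x = C n x" using False by simp
      ultimately show ?thesis using x y[of c z] by simp
    qed
    then show ?thesis by blast
  qed
qed simp

text \<open>A path to column \<open>n\<close>, row \<open>m\<close> can be continued by a path of
  the environment seen from that point. The induction adds the columns of the second stage one by
  one.\<close>

lemma directed_time_subadditive:
  "directed_time (n + k) (columns \<omega>) (m + y)
    \<le> directed_time n (columns \<omega>) m
      + directed_time k (columns (\<lambda>p. \<omega> (fst p + int n, snd p + m))) y"
proof (induction k arbitrary: y)
  case 0
  show ?case using directed_time_lipschitz[of n "columns \<omega>" "m + y" m] by simp
next
  case (Suc k)
  let ?\<omega>' = "\<lambda>p. \<omega> (fst p + int n, snd p + m)"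
  have "directed_time (n + Suc k) (columns \<omega>) (m + y) - directed_time n (columns \<omega>) m
    \<le> directed_time (Suc k) (columns ?\<omega>') y"
  proof (rule directed_time_Suc_greatest)
    fix z
    have "directed_time (n + Suc k) (columns \<omega>) (m + y) \<le> directed_time (n + k) (columns \<omega>) (m + z)
      + max 0 (columns \<omega> (n + k) (m + z)) + \<bar>real_of_int (m + z - (m + y))\<bar>"
      using directed_time_Suc_le[of "n + k" "columns \<omega>" "m + y" "m + z"] by simp
    moreover have "columns \<omega> (n + k) (m + z) = columns ?\<omega>' k z"
      by (simp add: columns_def add.commute)
    ultimately show "directed_time (n + Suc k) (columns \<omega>) (m + y) - directed_time n (columns \<omega>) m
      \<le> directed_time k (columns ?\<omega>') z + max 0 (columns ?\<omega>' k z) + \<bar>real_of_int (z - y)\<bar>"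
      using Suc.IH[of z] by simp
  qed
  then show ?case by linarith
qed

section \<open>Lattice paths and the identification of the two passage times\<close>

lemma is_path_snoc:
  assumes "is_path p u v" "adjacent v w"
  shows "is_path (p @ [w]) u w"
    and "path_time \<omega> (p @ [w]) = path_time \<omega> p + edge_weight \<omega> v w"
proof -
  have p: "p \<noteq> []" "hd p = u" "p ! (length p - 1) = v"
    using assms by (auto simp: is_path_def last_conv_nth)
  have adj: "adjacent ((p @ [w]) ! i) ((p @ [w]) ! Suc i)" if "i < length p" for i
  proof (cases "Suc i < length p")
    case True
    then show ?thesis using assms by (auto simp: is_path_def nth_append)
  next
    case False
    then have "i = length p - 1" using that by simp
    then show ?thesis using assms p that by (auto simp: nth_append)
  qed
  show "is_path (p @ [w]) u w" using p adj by (auto simp: is_path_def)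
  obtain l where l: "length p = Suc l" using p by (cases p) auto
  have "(\<Sum>i<l. edge_weight \<omega> ((p @ [w]) ! i) ((p @ [w]) ! Suc i)) =
    (\<Sum>i<l. edge_weight \<omega> (p ! i) (p ! Suc i))"
    using l by (intro sum.cong) (auto simp: nth_append)
  then show "path_time \<omega> (p @ [w]) = path_time \<omega> p + edge_weight \<omega> v w"
    using p l by (auto simp: path_time_def nth_append)
qed

text \<open>Telescoping along the path. Bounding by a potential replaces the surgery that would
  remove backtracking from an arbitrary path.\<close>

lemma path_time_lower_bound:
  assumes "is_path p u w"
    and step: "\<And>a b. adjacent a b \<Longrightarrow> \<phi> b \<le> \<phi> a + edge_weight \<omega> a b"
  shows "\<phi> w \<le> \<phi> u + path_time \<omega> p"
proof -
  have "\<phi> (p ! i) \<le> \<phi> u + (\<Sum>j<i. edge_weight \<omega> (p ! j) (p ! Suc j))" if "i \<le> length p - 1" for i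
    using that
  proof (induction i)
    case 0
    then show ?case using assms(1) by (auto simp: is_path_def hd_conv_nth)
  next
    case (Suc i)
    then show ?case using step[of "p ! i" "p ! Suc i"] assms(1) by (auto simp: is_path_def)
  qed
  from this[of "length p - 1"] show ?thesis
    using assms(1) by (auto simp: is_path_def path_time_def last_conv_nth)
qed

lemma edge_weight_nonneg:
  assumes "\<And>e. 0 \<le> \<omega> e"
  shows "0 \<le> edge_weight \<omega> a b"
  using assms by (auto simp: edge_weight_def)

lemma path_time_nonneg:
  assumes "\<And>e. 0 \<le> \<omega> e"
  shows "0 \<le> path_time \<omega> p"
  unfolding path_time_def by (intro sum_nonneg edge_weight_nonneg assms)

lemma passage_time_le:
  assumes "\<And>e. 0 \<le> \<omega> e" "is_path p u w"
  shows "passage_time \<omega> u w \<le> path_time \<omega> p"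
  unfolding passage_time_def
  using assms by (intro cInf_lower bdd_belowI[of _ 0]) (auto intro: path_time_nonneg)

text \<open>A witness form of "passage time at most \<open>t\<close>": paths can be extended by
  single edges without handling an infimum.\<close>

definition reachable :: "env \<Rightarrow> point \<Rightarrow> point \<Rightarrow> real \<Rightarrow> bool" where
  "reachable \<omega> u w t \<longleftrightarrow> (\<exists>p. is_path p u w \<and> path_time \<omega> p \<le> t)"

lemma reachable_step:
  assumes "reachable \<omega> u v t" "adjacent v w" "t + edge_weight \<omega> v w \<le> t'"
  shows "reachable \<omega> u w t'"
proof -
  obtain p where p: "is_path p u v" "path_time \<omega> p \<le> t"
    using assms(1) by (auto simp: reachable_def)
  show ?thesis unfolding reachable_def
    using is_path_snoc[OF p(1) assms(2)] p(2) assms(3)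
    by (intro exI[of _ "p @ [w]"]) (auto simp: is_path_snoc(2)[OF p(1) assms(2)])
qed

lemma reachable_vertical:
  assumes "reachable \<omega> u (x, y) t"
  shows "reachable \<omega> u (x, z) (t + \<bar>real_of_int (z - y)\<bar>)"
proof -
  \<comment> \<open>The sign \<open>s\<close> treats upward and downward runs in one
    induction.\<close>
  have "reachable \<omega> u (x, y + s * int j) (t + real j)" if "s = 1 \<or> s = -1" for j s
  proof (induction j)
    case 0
    then show ?case using assms by simp
  next
    case (Suc j)
    show ?case
      by (rule reachable_step[OF Suc]) (use that in \<open>auto simp: adjacent_def edge_weight_def algebra_simps\<close>)
  qed
  from this[of 1 "nat (z - y)"] this[of "-1" "nat (y - z)"] show ?thesis
    by (cases "y \<le> z") auto
qed

text \<open>The path follows nearly optimal crossing rows. The infima need not be known to be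
  attained, so \<open>\<delta>\<close> is halved at each column and must be general in the
  induction.\<close>

lemma reachable_directed_time:
  assumes "\<And>e. 0 \<le> \<omega> e" "\<delta> > 0"
  shows "reachable \<omega> (0, 0) (int n, y) (directed_time n (columns \<omega>) y + \<delta>)"
  using assms(2)
proof (induction n arbitrary: y \<delta>)
  case 0
  have "reachable \<omega> (0, 0) (0, 0) \<delta>"
    unfolding reachable_def using 0
    by (intro exI[of _ "[(0,0)]"]) (auto simp: is_path_def path_time_def)
  from reachable_vertical[OF this, of y] show ?case by (simp add: add.commute)
next
  case (Suc n)
  obtain z where z: "directed_time n (columns \<omega>) z + max 0 (columns \<omega> n z) + \<bar>real_of_int (z - y)\<bar>
    < directed_time (Suc n) (columns \<omega>) y + \<delta> / 2"
    using directed_time_Suc_approx half_gt_zero[OF Suc.prems] by blast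
  have w: "edge_weight \<omega> (int n, z) (int (Suc n), z) = max 0 (columns \<omega> n z)"
    using assms(1) by (simp add: edge_weight_def columns_def)
  have "reachable \<omega> (0, 0) (int (Suc n), z) 
    (directed_time n (columns \<omega>) z + \<delta> / 2 + max 0 (columns \<omega> n z))"
    by (rule reachable_step[OF Suc.IH[of "\<delta> / 2" z]])
      (use Suc.prems w in \<open>auto simp: adjacent_def\<close>)
  from reachable_vertical[OF this, of y]
  obtain p where "is_path p (0, 0) (int (Suc n), y)" "path_time \<omega> p \<le> directed_time n (columns \<omega>) z
     + \<delta> / 2 + max 0 (columns \<omega> n z) + \<bar>real_of_int (y - z)\<bar>"
    by (auto simp: reachable_def)
  with z show ?case
    unfolding reachable_def by (intro exI[of _ p]) auto
qed

text \<open>The directed time, extended constantly to the half-planes left of column \<open>0\<close> and right of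
  column \<open>n\<close>, is a potential that grows along each edge by at most the weight of the edge.\<close>

lemma directed_time_le_path_time:
  assumes "\<And>e. 0 \<le> \<omega> e" "is_path p (0, 0) (int n, y)"
  shows "directed_time n (columns \<omega>) y \<le> path_time \<omega> p"
proof -
  define \<phi> where "\<phi> a = directed_time (min n (nat (fst a))) (columns \<omega>) (snd a)" for a :: point
  \<comment> \<open>Both inequalities matter, since a path may traverse the edge leftwards as well:
    then the potential must not increase by more than the weight.\<close>
  have right: "\<phi> (x + 1, z) \<le> \<phi> (x, z) + \<omega> (x, z) \<and> \<phi> (x, z) \<le> \<phi> (x + 1, z)" for x z
  proof (cases "0 \<le> x \<and> x < int n")
    case True
    then have "min n (nat (x + 1)) = Suc (nat x)" "min n (nat x) = nat x" by auto
    moreover have "max 0 (columns \<omega> (nat x) z) = \<omega> (x, z)"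
      using True assms(1) by (auto simp: columns_def)
    ultimately show ?thesis
      using directed_time_Suc_le[of "nat x" "columns \<omega>" z z] 
        directed_time_le_Suc[of "nat x" "columns \<omega>" z]
      by (simp add: \<phi>_def)
  next
    case False
    then have "min n (nat (x + 1)) = min n (nat x)" by auto
    then show ?thesis using assms(1) by (simp add: \<phi>_def)
  qed
  have "\<phi> (int n, y) \<le> \<phi> (0, 0) + path_time \<omega> p"
  proof (rule path_time_lower_bound[OF assms(2)])
    fix a b assume ab: "adjacent a b"
    obtain x z x' z' where [simp]: "a = (x, z)" "b = (x', z')" by (cases a, cases b)
    consider "x' = x" "\<bar>z - z'\<bar> = 1" | "z' = z" "x' = x + 1" | "z' = z" "x = x' + 1"
      using ab unfolding adjacent_def by fastforce
    then show "\<phi> b \<le> \<phi> a + edge_weight \<omega> a b"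
    proof cases
      case 1
      then have "\<bar>real_of_int (z' - z)\<bar> = 1" by linarith
      then show ?thesis
        using 1 directed_time_lipschitz[of "min n (nat x)" "columns \<omega>" z' z]
        by (auto simp: \<phi>_def edge_weight_def)
    next
      case 2
      then show ?thesis using right[of x z] by (auto simp: edge_weight_def)
    next
      case 3
      then show ?thesis using right[of x' z] assms(1)[of "(x', z)"] by (auto simp: edge_weight_def)
    qed
  qed
  then show ?thesis by (simp add: \<phi>_def)
qed

lemma passage_time_eq_directed_time:
  assumes "\<And>e. 0 \<le> \<omega> e"
  shows "passage_time \<omega> (0, 0) (int n, y) = directed_time n (columns \<omega>) y"
proof (rule antisym)
  show "passage_time \<omega> (0, 0) (int n, y) \<le> directed_time n (columns \<omega>) y"
  proof (rule field_le_epsilon)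
    fix \<delta> :: real assume "\<delta> > 0"
    then obtain p where "is_path p (0, 0) (int n, y)"
      "path_time \<omega> p \<le> directed_time n (columns \<omega>) y + \<delta>"
      using reachable_directed_time[of \<omega> \<delta> n y] assms unfolding reachable_def by blast
    then show "passage_time \<omega> (0, 0) (int n, y) \<le> directed_time n (columns \<omega>) y + \<delta>"
      using passage_time_le[of \<omega> p] assms by fastforce
  qed
  \<comment> \<open>Some path must exist, for \<open>Inf\<close> of the empty set would carry no
    information.\<close>
  obtain p where "is_path p (0, 0) (int n, y)"
    using reachable_directed_time[of \<omega> 1 n y] assms unfolding reachable_def by auto
  then show "directed_time n (columns \<omega>) y \<le> passage_time \<omega> (0, 0) (int n, y)"
    unfolding passage_time_def
    by (intro cInf_greatest) (auto intro: directed_time_le_path_time assms)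
qed

text \<open>Each step is an infimum over the countable set of rows. The abstract \<open>C x\<close>
  lets the lemma serve both for environments and for finite products of columns.\<close>

lemma borel_measurable_directed_time:
  assumes "\<And>k z. k < n \<Longrightarrow> (\<lambda>x. C x k z) \<in> borel_measurable M"
  shows "(\<lambda>x. directed_time n (C x) y) \<in> borel_measurable M"
  using assms
proof (induction n arbitrary: y)
  case (Suc n)
  have [measurable]: "(\<lambda>x. directed_time n (C x) z) \<in> borel_measurable M"
    "(\<lambda>x. C x n z) \<in> borel_measurable M" for z using Suc by auto
  show ?case unfolding directed_time.simps
    by (rule borel_measurable_cINF[OF _ _ bdd_below_directed_step]) auto
qed simp

section \<open>Concentration for functions of independent variables\<close>

text \<open>Taylor expansion with Lagrange remainder, where \<open>exp t\<close> and
  \<open>x\<^sup>2 / 2\<close> are each at most \<open>exp x\<close>. The sign of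
  \<open>\<theta>\<close> is free, so both tails will be covered.\<close>

lemma exp_le_quadratic:
  fixes \<theta> x :: real
  assumes "\<bar>\<theta>\<bar> \<le> 1" "0 \<le> x"
  shows "exp (\<theta> * x) \<le> 1 + \<theta> * x + \<theta>\<^sup>2 * exp (2 * x)"
proof -
  obtain t where t: "\<bar>t\<bar> \<le> \<bar>\<theta> * x\<bar>"
    "exp (\<theta> * x) = (\<Sum>m<2. (\<theta> * x) ^ m / fact m) + exp t / fact 2 * (\<theta> * x) ^ 2"
    using Maclaurin_exp_le by blast
  have "\<bar>\<theta> * x\<bar> \<le> x" using assms by (simp add: abs_mult mult_left_le_one_le)
  then have "exp t \<le> exp x" using t(1) by simp
  moreover have "x\<^sup>2 / 2 \<le> exp x"
    using exp_lower_Taylor_quadratic[of x] assms by simp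
  ultimately have "exp t * (x\<^sup>2 / 2) \<le> exp x * exp x" by (intro mult_mono) auto
  then have "\<theta>\<^sup>2 * (exp t * (x\<^sup>2 / 2)) \<le> \<theta>\<^sup>2 * exp (2 * x)"
    by (intro mult_left_mono) (auto simp: mult_exp_exp)
  then show ?thesis
    using t(2) by (simp add: eval_nat_numeral field_simps)
qed

text \<open>Jensen's inequality for \<open>exp\<close>, by the tangent line at the mean; the right
  side is allowed to be infinite.\<close>

lemma (in prob_space) exp_expectation_le:
  fixes X :: "'a \<Rightarrow> real"
  assumes "integrable M X"
  shows "ennreal (exp (expectation X)) \<le> (\<integral>\<^sup>+x. ennreal (exp (X x)) \<partial>M)"
proof (cases "(\<integral>\<^sup>+x. ennreal (exp (X x)) \<partial>M) = \<infinity>")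
  case False
  have [measurable]: "X \<in> borel_measurable M" using assms by simp
  have int: "integrable M (\<lambda>x. exp (X x))"
    using False by (intro integrableI_nonneg) (auto simp: top.not_eq_extremum)
  let ?m = "expectation X"
  have "exp ?m * (1 + (X x - ?m)) \<le> exp (X x)" for x
  proof -
    have "exp ?m * (1 + (X x - ?m)) \<le> exp ?m * exp (X x - ?m)"
      by (intro mult_left_mono exp_ge_add_one_self) auto
    then show ?thesis by (simp add: mult_exp_exp)
  qed
  then have "expectation (\<lambda>x. exp ?m * (1 + (X x - ?m))) \<le> expectation (\<lambda>x. exp (X x))"
    using assms int by (intro integral_mono) auto
  moreover have "expectation (\<lambda>x. exp ?m * (1 + (X x - ?m))) = exp ?m"
    using assms by (simp add: prob_space)
  ultimately show ?thesis
    using int by (subst nn_integral_eq_integral) (auto intro: ennreal_leI)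
qed simp

text \<open>The quadratic bound is applied to \<open>X - a\<close>, which is nonnegative, and
  integrated; \<open>1 + x \<le> exp x\<close> then turns the result into an exponential whose
  linear term is exactly the mean.\<close>

lemma (in prob_space) exp_moment_one_sided:
  fixes X :: "'a \<Rightarrow> real"
  assumes [measurable]: "X \<in> borel_measurable M"
    and lower: "\<And>x. x \<in> space M \<Longrightarrow> a \<le> X x"
    and upper: "(\<integral>\<^sup>+x. ennreal (exp (2 * (X x - a))) \<partial>M) \<le> ennreal C"
  shows "integrable M X"
    and "\<bar>\<theta>\<bar> \<le> 1 \<Longrightarrow>
      (\<integral>\<^sup>+x. ennreal (exp (\<theta> * X x)) \<partial>M) \<le> ennreal (exp (\<theta> * expectation X + C * \<theta>\<^sup>2))"
proof -
  have int2: "integrable M (\<lambda>x. exp (2 * (X x - a)))"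
    using upper by (intro integrableI_nonneg) (auto intro: order.strict_trans1)
  have bound: "\<bar>X x - a\<bar> \<le> exp (2 * (X x - a))" if "x \<in> space M" for x
    using exp_ge_add_one_self[of "2 * (X x - a)"] lower[OF that] by (smt (verit))
  have "integrable M (\<lambda>x. X x - a)"
    by (rule Bochner_Integration.integrable_bound[OF int2]) (use bound in auto)
  from Bochner_Integration.integrable_add[OF this integrable_const[of a]]
  show int: "integrable M X" by simp
  have "(\<integral>\<^sup>+x. ennreal (exp (2 * (X x - a))) \<partial>M) = ennreal (expectation (\<lambda>x. exp (2 * (X x - a))))"
    by (intro nn_integral_eq_integral int2) auto
  \<comment> \<open>This excludes a negative \<open>C\<close>, which \<open>ennreal\<close> would
    send to 0.\<close>
  moreover have "1 \<le> expectation (\<lambda>x. exp (2 * (X x - a)))"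
    using lower by (intro integral_ge_const int2) auto
  ultimately have C: "expectation (\<lambda>x. exp (2 * (X x - a))) \<le> C"
    using upper by (auto simp: ennreal_le_iff2)
  assume \<theta>: "\<bar>\<theta>\<bar> \<le> 1"
  let ?q = "\<lambda>x. 1 + \<theta> * (X x - a) + \<theta>\<^sup>2 * exp (2 * (X x - a))"
  have q: "exp (\<theta> * X x) \<le> exp (\<theta> * a) * ?q x" if "x \<in> space M" for x
  proof -
    have "exp (\<theta> * X x) = exp (\<theta> * a) * exp (\<theta> * (X x - a))"
      by (simp add: mult_exp_exp algebra_simps)
    then show ?thesis using exp_le_quadratic[OF \<theta>, of "X x - a"] lower[OF that] by simp
  qed
  have intq: "integrable M (\<lambda>x. exp (\<theta> * a) * ?q x)" using int int2 by simp
  have pos: "0 \<le> exp (\<theta> * a) * ?q x" if "x \<in> space M" for x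
    using q[OF that] exp_ge_zero by (rule order_trans[rotated])
  have "(\<integral>\<^sup>+x. ennreal (exp (\<theta> * X x)) \<partial>M) \<le> (\<integral>\<^sup>+x. ennreal (exp (\<theta> * a) * ?q x) \<partial>M)"
    by (intro nn_integral_mono ennreal_leI q)
  also have "\<dots> = ennreal (expectation (\<lambda>x. exp (\<theta> * a) * ?q x))"
    by (rule nn_integral_eq_integral[OF intq]) (use pos in auto)
  also have "expectation (\<lambda>x. exp (\<theta> * a) * ?q x) =
    exp (\<theta> * a) * (1 + (\<theta> * (expectation X - a) + \<theta>\<^sup>2 * expectation (\<lambda>x. exp (2 * (X x - a)))))"
    using int int2 by (simp add: prob_space add.assoc)
  also have "\<dots> \<le> exp (\<theta> * a) * (1 + (\<theta> * (expectation X - a) + \<theta>\<^sup>2 * C))"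
    using C by (intro mult_left_mono add_left_mono) auto
  also have "\<dots> \<le> exp (\<theta> * a) * exp (\<theta> * (expectation X - a) + \<theta>\<^sup>2 * C)"
    by (intro mult_left_mono exp_ge_add_one_self) auto
  also have "\<dots> = exp (\<theta> * expectation X + C * \<theta>\<^sup>2)"
    by (simp add: mult_exp_exp algebra_simps)
  finally show "(\<integral>\<^sup>+x. ennreal (exp (\<theta> * X x)) \<partial>M)
    \<le> ennreal (exp (\<theta> * expectation X + C * \<theta>\<^sup>2))"
    by (simp add: ennreal_leI)
qed

lemma space_PiM_update:
  assumes "x \<in> space (PiM I (\<lambda>_. Q))" "c \<in> space Q"
  shows "x(i := c) \<in> space (PiM (insert i I) (\<lambda>_. Q))"
  using assms by (auto simp: space_PiM PiE_iff extensional_def)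

text \<open>The influence of a coordinate is measured one-sidedly, against a baseline value \<open>b\<close> at which
  \<open>f\<close> is minimal in that coordinate.\<close>

definition bounded_influence ::
    "'a measure \<Rightarrow> 'i set \<Rightarrow> 'a \<Rightarrow> real \<Rightarrow> (('i \<Rightarrow> 'a) \<Rightarrow> real) \<Rightarrow> bool" where
  "bounded_influence Q I b C f \<longleftrightarrow> f \<in> borel_measurable (PiM I (\<lambda>_. Q)) \<and>
    (\<forall>k\<in>I. \<forall>x\<in>space (PiM I (\<lambda>_. Q)).
      (\<forall>c\<in>space Q. f (x(k := b)) \<le> f (x(k := c))) \<and>
      (\<integral>\<^sup>+c. ennreal (exp (2 * (f (x(k := c)) - f (x(k := b))))) \<partial>Q) \<le> ennreal C)"

context
  fixes Q :: "'a measure" and b :: 'a and C :: real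
  assumes Q: "prob_space Q" and b: "b \<in> space Q"
begin

interpretation Q: prob_space Q by (rule Q)
interpretation P: product_sigma_finite "\<lambda>_::'i. Q" ..

text \<open>Prepares for peeling off coordinate \<open>i\<close>: first the facts about
  \<open>i\<close> itself, then those about the other coordinates with \<open>i\<close> held fixed,
  obtained by commuting the two updates.\<close>

lemma bounded_influence_insert:
  assumes f: "bounded_influence Q (insert i I) b C f" and i: "i \<notin> I"
  shows "(\<lambda>(x, c). f (x(i := c))) \<in> borel_measurable (PiM I (\<lambda>_. Q) \<Otimes>\<^sub>M Q)"
    and "x \<in> space (PiM I (\<lambda>_. Q)) \<Longrightarrow> (\<lambda>c. f (x(i := c))) \<in> borel_measurable Q"
    and "x \<in> space (PiM I (\<lambda>_. Q)) \<Longrightarrow> c \<in> space Q \<Longrightarrow> f (x(i := b)) \<le> f (x(i := c))"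
    and "x \<in> space (PiM I (\<lambda>_. Q)) \<Longrightarrow>
      (\<integral>\<^sup>+c. ennreal (exp (2 * (f (x(i := c)) - f (x(i := b))))) \<partial>Q) \<le> ennreal C"
    and "k \<in> I \<Longrightarrow> x \<in> space (PiM I (\<lambda>_. Q)) \<Longrightarrow> c \<in> space Q \<Longrightarrow> c' \<in> space Q \<Longrightarrow>
      f (x(k := b, i := c)) \<le> f (x(k := c', i := c))"
    and "k \<in> I \<Longrightarrow> x \<in> space (PiM I (\<lambda>_. Q)) \<Longrightarrow> c \<in> space Q \<Longrightarrow>
      (\<integral>\<^sup>+c'. ennreal (exp (2 * (f (x(k := c', i := c)) - f (x(k := b, i := c))))) \<partial>Q) \<le> ennreal C"
proof -
  have fm: "f \<in> borel_measurable (PiM (insert i I) (\<lambda>_. Q))"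
    using f by (simp add: bounded_influence_def)
  have "(\<lambda>(x, c). x(i := c)) \<in> measurable (PiM I (\<lambda>_. Q) \<Otimes>\<^sub>M Q) (PiM (insert i I) (\<lambda>_. Q))"
    by (rule measurable_add_dim)
  from measurable_compose[OF this fm]
  show "(\<lambda>(x, c). f (x(i := c))) \<in> borel_measurable (PiM I (\<lambda>_. Q) \<Otimes>\<^sub>M Q)"
    by (simp add: case_prod_beta')
  show "(\<lambda>c. f (x(i := c))) \<in> borel_measurable Q" if "x \<in> space (PiM I (\<lambda>_. Q))"
    using measurable_compose[OF measurable_component_update[OF that i] fm] .
  have *: "x(i := c) \<in> space (PiM (insert i I) (\<lambda>_. Q))"
    if "x \<in> space (PiM I (\<lambda>_. Q))" "c \<in> space Q" for c x
    using space_PiM_update[OF that] .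
  show "f (x(i := b)) \<le> f (x(i := c))" if "x \<in> space (PiM I (\<lambda>_. Q))" "c \<in> space Q"
    using f *[OF that(1) b] that(2) unfolding bounded_influence_def by fastforce
  show "(\<integral>\<^sup>+c. ennreal (exp (2 * (f (x(i := c)) - f (x(i := b))))) \<partial>Q) \<le> ennreal C"
    if "x \<in> space (PiM I (\<lambda>_. Q))"
    using f *[OF that b] unfolding bounded_influence_def by fastforce
  have tw: "x(k := c', i := c) = x(i := c, k := c')" if "k \<in> I" for c c'
    using i that by (auto intro!: fun_upd_twist)
  show "f (x(k := b, i := c)) \<le> f (x(k := c', i := c))"
    if "k \<in> I" "x \<in> space (PiM I (\<lambda>_. Q))" "c \<in> space Q" "c' \<in> space Q"
    using f *[OF that(2,3)] that(1,4) unfolding bounded_influence_def tw[OF that(1)] by fastforce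
  show "(\<integral>\<^sup>+c'. ennreal (exp (2 * (f (x(k := c', i := c)) - f (x(k := b, i := c))))) \<partial>Q) \<le> ennreal C"
    if "k \<in> I" "x \<in> space (PiM I (\<lambda>_. Q))" "c \<in> space Q"
    using f *[OF that(2,3)] that(1) unfolding bounded_influence_def tw[OF that(1)] by fastforce
qed

lemma bounded_influence_section:
  assumes f: "bounded_influence Q (insert i I) b C f" and i: "i \<notin> I" 
    and x: "x \<in> space (PiM I (\<lambda>_. Q))"
  shows "integrable Q (\<lambda>c. f (x(i := c)))"
    and "\<bar>\<theta>\<bar> \<le> 1 \<Longrightarrow> (\<integral>\<^sup>+c. ennreal (exp (\<theta> * f (x(i := c)))) \<partial>Q)
      \<le> ennreal (exp (\<theta> * (\<integral>c. f (x(i := c)) \<partial>Q) + C * \<theta>\<^sup>2))"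
  using Q.exp_moment_one_sided[OF bounded_influence_insert(2-4)[OF f i x]] x by auto

text \<open>Freezing \<open>i\<close> at the baseline serves the integrability induction, as
  averaging over \<open>i\<close> serves the moment bound.\<close>

lemma bounded_influence_fix:
  assumes f: "bounded_influence Q (insert i I) b C f" and i: "i \<notin> I"
  shows "bounded_influence Q I b C (\<lambda>x. f (x(i := b)))"
proof -
  have "(\<lambda>x. case (x, b) of (x, c) \<Rightarrow> f (x(i := c))) \<in> borel_measurable (PiM I (\<lambda>_. Q))"
    by (rule measurable_compose[OF _ bounded_influence_insert(1)[OF f i]]) (use b in simp)
  then show ?thesis
    unfolding bounded_influence_def using bounded_influence_insert(5,6)[OF f i] b by auto
qed

text \<open>Jensen moves the average over \<open>i\<close> outside the exponential and Tonelli makes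
  it the outer integral; the inner one is then bounded by \<open>C\<close> for every fixed value of
  \<open>i\<close>. Hence the constant does not deteriorate.\<close>

lemma bounded_influence_average:
  assumes f: "bounded_influence Q (insert i I) b C f" and i: "i \<notin> I"
  shows "bounded_influence Q I b C (\<lambda>x. \<integral>c. f (x(i := c)) \<partial>Q)"
  unfolding bounded_influence_def
proof (intro conjI ballI)
  show "(\<lambda>x. \<integral>c. f (x(i := c)) \<partial>Q) \<in> borel_measurable (PiM I (\<lambda>_. Q))"
    by (rule Q.borel_measurable_lebesgue_integral[OF bounded_influence_insert(1)[OF f i]])
next
  fix k x c assume k: "k \<in> I" and x: "x \<in> space (PiM I (\<lambda>_. Q))" and c: "c \<in> space Q"
  have up: "x(k := d) \<in> space (PiM I (\<lambda>_. Q))" if "d \<in> space Q" for d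
    using space_PiM_update[OF x that, of k] k by (simp add: insert_absorb)
  show "(\<integral>c'. f (x(k := b, i := c')) \<partial>Q) \<le> (\<integral>c'. f (x(k := c, i := c')) \<partial>Q)"
    by (intro integral_mono bounded_influence_section(1)[OF f i] up b c
        bounded_influence_insert(5)[OF f i] k x)
next
  fix k x assume k: "k \<in> I" and x: "x \<in> space (PiM I (\<lambda>_. Q))"
  have up: "x(k := d) \<in> space (PiM I (\<lambda>_. Q))" if "d \<in> space Q" for d
    using space_PiM_update[OF x that, of k] k by (simp add: insert_absorb)
  let ?d = "\<lambda>c c'. 2 * (f (x(k := c, i := c')) - f (x(k := b, i := c')))"
  have [measurable]: "(\<lambda>(c, c'). f (x(k := c, i := c'))) \<in> borel_measurable (Q \<Otimes>\<^sub>M Q)"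
  proof -
    have "(\<lambda>p. x(k := fst p)) \<in> measurable (Q \<Otimes>\<^sub>M Q) (PiM I (\<lambda>_. Q))"
      by (rule measurable_fun_upd[where J=I]) (use k x in auto)
    then have "(\<lambda>p. (x(k := fst p), snd p)) \<in> measurable (Q \<Otimes>\<^sub>M Q) (PiM I (\<lambda>_. Q) \<Otimes>\<^sub>M Q)" 
      by simp
    from measurable_compose[OF this bounded_influence_insert(1)[OF f i]]
    show ?thesis by (simp add: case_prod_beta')
  qed
  have [measurable]: "(\<lambda>c'. f (x(k := b, i := c'))) \<in> borel_measurable Q"
    using bounded_influence_insert(2)[OF f i up[OF b]] .
  interpret QQ: pair_sigma_finite Q Q ..
  have "(\<integral>\<^sup>+c. ennreal (exp (2 * ((\<integral>c'. f (x(k := c, i := c')) \<partial>Q)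
      - (\<integral>c'. f (x(k := b, i := c')) \<partial>Q)))) \<partial>Q)
    \<le> (\<integral>\<^sup>+c. (\<integral>\<^sup>+c'. ennreal (exp (?d c c')) \<partial>Q) \<partial>Q)"
  proof (rule nn_integral_mono)
    fix c assume c: "c \<in> space Q"
    have int: "integrable Q (?d c)"
      using bounded_influence_section(1)[OF f i] up b c by auto
    have "2 * ((\<integral>c'. f (x(k := c, i := c')) \<partial>Q) - (\<integral>c'. f (x(k := b, i := c')) \<partial>Q))
      = (\<integral>c'. ?d c c' \<partial>Q)"
      using bounded_influence_section(1)[OF f i] up b c by simp
    then show "ennreal (exp (2 * ((\<integral>c'. f (x(k := c, i := c')) \<partial>Q)
      - (\<integral>c'. f (x(k := b, i := c')) \<partial>Q)))) \<le> (\<integral>\<^sup>+c'. ennreal (exp (?d c c')) \<partial>Q)"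
      using Q.exp_expectation_le[OF int] by simp
  qed
  also have "\<dots> = (\<integral>\<^sup>+c'. (\<integral>\<^sup>+c. ennreal (exp (?d c c')) \<partial>Q) \<partial>Q)"
    by (rule QQ.Fubini'[symmetric]) simp
  also have "\<dots> \<le> (\<integral>\<^sup>+c'. ennreal C \<partial>Q)"
    by (intro nn_integral_mono bounded_influence_insert(6)[OF f i k x])
  also have "\<dots> = ennreal C" by (simp add: Q.emeasure_space_1)
  finally show "(\<integral>\<^sup>+c. ennreal (exp (2 * ((\<integral>c'. f (x(k := c, i := c')) \<partial>Q)
      - (\<integral>c'. f (x(k := b, i := c')) \<partial>Q)))) \<partial>Q) \<le> ennreal C" .
qed

text \<open>With \<open>?h\<close> the section at the baseline, \<open>\<bar>f\<bar>\<close> is at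
  most \<open>(f - ?h) + \<bar>?h\<bar>\<close>: the first term is controlled by the exponential
  moment, the second by induction.\<close>

lemma bounded_influence_integrable:
  assumes "finite I" "bounded_influence Q I b C f"
  shows "integrable (PiM I (\<lambda>_. Q)) f"
  using assms
proof (induction I arbitrary: f rule: finite_induct)
  case empty
  show ?case
    by (simp add: PiM_empty integrable_count_space)
next
  case (insert i I)
  note f = insert.prems and i = insert.hyps(2)
  interpret I: prob_space "PiM I (\<lambda>_. Q)" by (intro prob_space_PiM Q)
  have fm [measurable]: "f \<in> borel_measurable (PiM (insert i I) (\<lambda>_. Q))"
    using f by (simp add: bounded_influence_def)
  let ?h = "\<lambda>x. f (x(i := b))"
  have h: "integrable (PiM I (\<lambda>_. Q)) ?h"
    by (rule insert.IH[OF bounded_influence_fix[OF f i]])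
  have "(\<integral>\<^sup>+x. ennreal (norm (f x)) \<partial>PiM (insert i I) (\<lambda>_. Q))
    = (\<integral>\<^sup>+x. (\<integral>\<^sup>+c. ennreal (norm (f (x(i := c)))) \<partial>Q) \<partial>PiM I (\<lambda>_. Q))"
    using insert.hyps by (intro P.product_nn_integral_insert) auto
  also have "\<dots> \<le> (\<integral>\<^sup>+x. ennreal C + ennreal (norm (?h x)) \<partial>PiM I (\<lambda>_. Q))"
  proof (rule nn_integral_mono)
    fix x assume x: "x \<in> space (PiM I (\<lambda>_. Q))"
    note m [measurable] = bounded_influence_insert(2)[OF f i x]
    have "(\<integral>\<^sup>+c. ennreal (norm (f (x(i := c)))) \<partial>Q)
      \<le> (\<integral>\<^sup>+c. ennreal (exp (2 * (f (x(i := c)) - ?h x))) + ennreal (norm (?h x)) \<partial>Q)"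
    proof (rule nn_integral_mono)
      fix c assume c: "c \<in> space Q"
      have "norm (f (x(i := c))) \<le> exp (2 * (f (x(i := c)) - ?h x)) + norm (?h x)"
        using exp_ge_add_one_self[of "2 * (f (x(i := c)) - ?h x)"]
          bounded_influence_insert(3)[OF f i x c] unfolding real_norm_def by (smt (verit))
      then show "ennreal (norm (f (x(i := c))))
        \<le> ennreal (exp (2 * (f (x(i := c)) - ?h x))) + ennreal (norm (?h x))"
        by (simp add: ennreal_leI flip: ennreal_plus)
    qed
    also have "\<dots> = (\<integral>\<^sup>+c. ennreal (exp (2 * (f (x(i := c)) - ?h x))) \<partial>Q) + ennreal (norm (?h x))"
      by (subst nn_integral_add) (auto simp: Q.emeasure_space_1)
    also have "\<dots> \<le> ennreal C + ennreal (norm (?h x))"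
      by (intro add_right_mono bounded_influence_insert(4)[OF f i x])
    finally show "(\<integral>\<^sup>+c. ennreal (norm (f (x(i := c)))) \<partial>Q) \<le> ennreal C + ennreal (norm (?h x))" .
  qed
  also have "\<dots> = ennreal C + (\<integral>\<^sup>+x. ennreal (norm (?h x)) \<partial>PiM I (\<lambda>_. Q))"
    using h by (subst nn_integral_add) (auto simp: I.emeasure_space_1)
  also have "\<dots> < \<infinity>" using h by (auto simp: integrable_iff_bounded)
  finally show ?case by (intro integrableI_bounded) auto
qed

text \<open>Integrating out coordinate \<open>i\<close> costs a factor
  \<open>exp (C * \<theta>\<^sup>2)\<close> and leaves the average \<open>?g\<close>, which has the
  same mean as \<open>f\<close> and the same influence constant. The factors multiply over
  \<open>I\<close>.\<close>

theorem bounded_influence_exp_moment: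
  assumes "finite I" "bounded_influence Q I b C f" "\<bar>\<theta>\<bar> \<le> 1"
  shows "(\<integral>\<^sup>+x. ennreal (exp (\<theta> * f x)) \<partial>PiM I (\<lambda>_. Q))
    \<le> ennreal (exp (\<theta> * (\<integral>x. f x \<partial>PiM I (\<lambda>_. Q)) + real (card I) * C * \<theta>\<^sup>2))"
  using assms(1,2)
proof (induction I arbitrary: f rule: finite_induct)
  case empty
  show ?case
    by (simp add: PiM_empty nn_integral_count_space_finite lebesgue_integral_count_space_finite)
next
  case (insert i I)
  note f = insert.prems and i = insert.hyps(2)
  have fm [measurable]: "f \<in> borel_measurable (PiM (insert i I) (\<lambda>_. Q))"
    using f by (simp add: bounded_influence_def)
  let ?g = "\<lambda>x. \<integral>c. f (x(i := c)) \<partial>Q"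
  note g = bounded_influence_average[OF f i]
  have gm [measurable]: "?g \<in> borel_measurable (PiM I (\<lambda>_. Q))"
    using g by (simp add: bounded_influence_def)
  have mean: "(\<integral>x. f x \<partial>PiM (insert i I) (\<lambda>_. Q)) = (\<integral>x. ?g x \<partial>PiM I (\<lambda>_. Q))"
    using insert by (intro P.product_integral_insert bounded_influence_integrable) auto
  have "(\<integral>\<^sup>+x. ennreal (exp (\<theta> * f x)) \<partial>PiM (insert i I) (\<lambda>_. Q))
    = (\<integral>\<^sup>+x. (\<integral>\<^sup>+c. ennreal (exp (\<theta> * f (x(i := c)))) \<partial>Q) \<partial>PiM I (\<lambda>_. Q))"
    using insert.hyps by (intro P.product_nn_integral_insert) auto
  also have "\<dots> \<le> (\<integral>\<^sup>+x. ennreal (exp (C * \<theta>\<^sup>2)) * ennreal (exp (\<theta> * ?g x)) \<partial>PiM I (\<lambda>_. Q))"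
  proof (rule nn_integral_mono)
    fix x assume "x \<in> space (PiM I (\<lambda>_. Q))"
    note bounded_influence_section(2)[OF f i this assms(3)]
    also have "ennreal (exp (\<theta> * ?g x + C * \<theta>\<^sup>2)) =
      ennreal (exp (C * \<theta>\<^sup>2)) * ennreal (exp (\<theta> * ?g x))"
      by (simp add: exp_add mult.commute flip: ennreal_mult)
    finally show "(\<integral>\<^sup>+c. ennreal (exp (\<theta> * f (x(i := c)))) \<partial>Q)
      \<le> ennreal (exp (C * \<theta>\<^sup>2)) * ennreal (exp (\<theta> * ?g x))" .
  qed
  also have "\<dots> = ennreal (exp (C * \<theta>\<^sup>2)) * (\<integral>\<^sup>+x. ennreal (exp (\<theta> * ?g x)) \<partial>PiM I (\<lambda>_. Q))"
    by (rule nn_integral_cmult) simp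
  also have "\<dots> \<le> ennreal (exp (C * \<theta>\<^sup>2)) *
    ennreal (exp (\<theta> * (\<integral>x. ?g x \<partial>PiM I (\<lambda>_. Q)) + real (card I) * C * \<theta>\<^sup>2))"
    by (intro mult_left_mono insert.IH g) auto
  also have "\<dots> = ennreal (exp (\<theta> * (\<integral>x. f x \<partial>PiM (insert i I) (\<lambda>_. Q))
      + real (card (insert i I)) * C * \<theta>\<^sup>2))"
    using insert.hyps by (simp add: mean mult_exp_exp algebra_simps flip: ennreal_mult)
  finally show ?case .
qed

end

section \<open>Convergence of subadditive sequences\<close>

text \<open>The limit is the infimum of the quotients; the upper bound divides \<open>n\<close> by
  an index \<open>m\<close> whose quotient is nearly minimal.\<close>

lemma fekete:
  fixes u :: "nat \<Rightarrow> real"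
  assumes sub: "\<And>m n. m > 0 \<Longrightarrow> n > 0 \<Longrightarrow> u (m + n) \<le> u m + u n" and nonneg: "\<And>n. 0 \<le> u n"
  shows "convergent (\<lambda>n. u n / real n)"
proof -
  define L where "L = (INF n\<in>{0<..}. u n / real n)"
  have bdd: "bdd_below ((\<lambda>n. u n / real n) ` {0<..})"
    using nonneg by (intro bdd_belowI[of _ 0]) auto
  have lower: "L \<le> u n / real n" if "n > 0" for n
    unfolding L_def using that by (intro cINF_lower bdd) auto
  have upper: "\<forall>\<^sub>F n in sequentially. u n / real n < L + e" if "e > 0" for e
  proof -
    have "\<exists>m\<in>{0<..}. u m / real m < L + e / 2"
      using that bdd by (subst cINF_less_iff[symmetric]) (auto simp: L_def)
    then obtain m where m: "m > 0" "u m / real m < L + e / 2" by auto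
    define R where "R = Max (u ` {1..m})"
    have mult: "u (q * m + r) \<le> real q * u m + u r" if "r > 0" for q r
    proof (induction q)
      case (Suc q)
      have "u (Suc q * m + r) = u (m + (q * m + r))" by (simp add: algebra_simps)
      also have "\<dots> \<le> u m + u (q * m + r)" using m(1) that by (intro sub) auto
      finally show ?case using Suc by (simp add: algebra_simps)
    qed simp
    have bound: "u n / real n \<le> u m / real m + R / real n" if "n > 0" for n
    proof -
      \<comment> \<open>Dividing \<open>n - 1\<close> puts the remainder in \<open>{1..m}\<close>,
        because subadditivity is assumed for positive indices only.\<close>
      let ?q = "(n - 1) div m" and ?r = "(n - 1) mod m + 1"
      have n: "n = ?q * m + ?r" using that by (simp add: div_mult_mod_eq)
      have "u ?r \<le> R" unfolding R_def using m(1)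
        by (intro Max_ge) (auto simp: Suc_le_eq)
      then have "u n \<le> real ?q * u m + R" using mult[of ?r ?q] n by simp
      moreover have "real ?q * u m \<le> real n / real m * u m"
      proof (intro mult_right_mono nonneg)
        have "real (?q * m) \<le> real n" using n by linarith
        then show "real ?q \<le> real n / real m" using m(1) by (simp add: field_simps)
      qed
      ultimately have "u n \<le> real n / real m * u m + R" by linarith
      then show ?thesis using that m(1) by (simp add: field_simps)
    qed
    have "(\<lambda>n. R / real n) \<longlonglongrightarrow> 0" by (rule lim_const_over_n)
    then have "\<forall>\<^sub>F n in sequentially. R / real n < e / 2"
      using that by (intro order_tendstoD) auto
    then show ?thesis using eventually_gt_at_top[of 0]
    proof eventually_elim
      case (elim n)
      then show ?case using bound[of n] m(2) by linarith
    qed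
  qed
  have "(\<lambda>n. u n / real n) \<longlonglongrightarrow> L"
  proof (rule order_tendstoI)
    fix x assume "x < L"
    then show "\<forall>\<^sub>F n in sequentially. x < u n / real n"
      using lower by (intro eventually_mono[OF eventually_gt_at_top[of 0]]) (rule less_le_trans)
  next
    fix x assume "L < x"
    then show "\<forall>\<^sub>F n in sequentially. u n / real n < x" using upper[of "x - L"] by simp
  qed
  then show ?thesis by (rule convergentI)
qed

section \<open>Passage times in a random environment\<close>

context
  fixes G :: "real measure"
  assumes prob_G: "prob_space G" and sets_G: "sets G = sets borel"
begin

interpretation G: prob_space G by (rule prob_G)
interpretation env: product_prob_space "\<lambda>_::point. G" UNIV ..
interpretation col: product_prob_space "\<lambda>_::int. G" UNIV ..
interpretation fpp: prob_space "fpp_space G"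
  unfolding fpp_space_def by (intro prob_space_PiM prob_G)

abbreviation column_space :: "(int \<Rightarrow> real) measure" where
  "column_space \<equiv> PiM UNIV (\<lambda>_::int. G)"

lemma space_G: "space G = UNIV"
  using sets_eq_imp_space_eq[OF sets_G] by simp

lemma space_column_space: "space column_space = UNIV"
  by (simp add: space_PiM space_G)

lemma space_fpp_space: "space (fpp_space G) = UNIV"
  by (simp add: fpp_space_def space_PiM space_G)

lemma borel_measurable_coordinate:
  "(\<lambda>c. c z) \<in> borel_measurable column_space"
  using measurable_component_singleton[of z UNIV "\<lambda>_. G"] by (simp add: measurable_cong_sets[OF refl sets_G])

lemma borel_measurable_fpp_coordinate:
  "(\<lambda>\<omega>. \<omega> p) \<in> borel_measurable (fpp_space G)"
  using measurable_component_singleton[of p UNIV "\<lambda>_. G"]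
  by (simp add: fpp_space_def measurable_cong_sets[OF refl sets_G])

lemma borel_measurable_directed_time_columns:
  "(\<lambda>\<omega>. directed_time n (columns \<omega>) y) \<in> borel_measurable (fpp_space G)"
  by (intro borel_measurable_directed_time) (simp add: columns_def borel_measurable_fpp_coordinate)

section \<open>Crossing cost of a single column\<close>

lemma obtain_small_tail:
  assumes "\<delta> > 0"
  obtains L where "0 \<le> L" "G.prob {L<..} < \<delta>"
proof -
  have "(\<lambda>i. G.prob {real i<..}) \<longlonglongrightarrow> G.prob (\<Inter>i. {real i<..})"
    by (rule G.finite_Lim_measure_decseq) (auto simp: sets_G decseq_def)
  moreover have "(\<Inter>i. {real i<..}) = {}"
  proof -
    have "\<exists>i. \<not> real i < x" for x
      using real_arch_simple[of x] by (auto simp: not_less)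
    then show ?thesis by auto
  qed
  ultimately have "(\<lambda>i. G.prob {real i<..}) \<longlonglongrightarrow> 0" by simp
  from order_tendstoD(2)[OF this assms] obtain i where "G.prob {real i<..} < \<delta>"
    by (auto simp: eventually_sequentially)
  then show ?thesis using that[of "real i"] by simp
qed

lemma emeasure_all_large:
  "emeasure column_space {c \<in> space column_space. \<forall>i<j. c (y + int i) \<in> {L<..}}
    = ennreal (G.prob {L<..} ^ j)"
proof -
  let ?J = "(\<lambda>i. y + int i) ` {..<j}"
  have "{c \<in> space column_space. \<forall>i<j. c (y + int i) \<in> {L<..}}
    = {c \<in> space column_space. \<forall>i\<in>?J. c i \<in> {L<..}}" by auto
  also have "emeasure column_space \<dots> = (\<Prod>i\<in>?J. emeasure G {L<..})"
    by (rule col.emeasure_PiM_Collect) (auto simp: sets_G)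
  also have "\<dots> = emeasure G {L<..} ^ j"
    by (simp add: card_image inj_on_def)
  finally show ?thesis by (simp add: G.emeasure_eq_measure ennreal_power)
qed

text \<open>The crossing cost of a column has exponential moments without any assumption on \<open>G\<close>: it
  exceeds \<open>1 + L + 2 j\<close> only if the weights in \<open>j + 1\<close> consecutive rows are all larger than
  \<open>L\<close>.\<close>

lemma exp_moment_crossing_cost:
  obtains K where "K > 0" "\<And>h y. (\<And>c z. h c \<le> 1 + 2 * \<bar>real_of_int (z - y)\<bar> + max 0 (c z)) \<Longrightarrow>
    (\<integral>\<^sup>+c. ennreal (exp (2 * h c)) \<partial>column_space) \<le> ennreal K"
proof -
  \<comment> \<open>The weights \<open>t j\<close> below grow like \<open>exp (4 * j)\<close>; this
    threshold leaves a geometric series of ratio 1/2.\<close>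
  obtain L where L: "0 \<le> L" "G.prob {L<..} < exp (-4) / 2"
    using obtain_small_tail[of "exp (-4) / 2"] by auto
  let ?K = "2 * exp (2 * (1 + L))"
  have bound: "(\<integral>\<^sup>+c. ennreal (exp (2 * h c)) \<partial>column_space) \<le> ennreal ?K"
    if h: "\<And>c z. h c \<le> 1 + 2 * \<bar>real_of_int (z - y)\<bar> + max 0 (c z)" for h y
  proof -
    define A where "A j = {c \<in> space column_space. \<forall>i<j. c (y + int i) \<in> {L<..}}" for j
    define t where "t j = exp (2 * (1 + 2 * real j + L))" for j
    have A [measurable]: "A j \<in> sets column_space" for j
    proof -
      have [measurable]: "(\<lambda>c. c z) \<in> borel_measurable column_space" for z
        by (rule borel_measurable_coordinate)
      show ?thesis unfolding A_def by measurable
    qed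
    have "ennreal (exp (2 * h c)) \<le> (\<Sum>j. ennreal (t j) * indicator (A j) c)" for c
    proof (cases "\<exists>j. c (y + int j) \<le> L")
      case True
      \<comment> \<open>The first cheap row at or above \<open>y\<close>; rows below
        \<open>y\<close> are not searched.\<close>
      define j where "j = (LEAST j. c (y + int j) \<le> L)"
      have j: "c (y + int j) \<le> L" unfolding j_def using True by (rule LeastI_ex)
      have "c (y + int i) > L" if "i < j" for i
        using not_less_Least[of i "\<lambda>j. c (y + int j) \<le> L"] that by (auto simp: j_def)
      then have "c \<in> A j" by (auto simp: A_def space_column_space)
      have "h c \<le> 1 + 2 * real j + L" using h[of c "y + int j"] j L(1) by auto
      then have "ennreal (exp (2 * h c)) \<le> (\<Sum>j\<in>{j}. ennreal (t j) * indicator (A j) c)"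
        using \<open>c \<in> A j\<close> by (auto simp: t_def intro!: ennreal_leI)
      also have "\<dots> \<le> (\<Sum>j. ennreal (t j) * indicator (A j) c)"
        by (intro sum_le_suminf) auto
      finally show ?thesis .
    next
      case False
      \<comment> \<open>Without a cheap row, \<open>c\<close> lies in every \<open>A j\<close> and
        the series is infinite, so the domination holds everywhere and no null set has to be
        removed.\<close>
      then have inA: "c \<in> A j" for j by (auto simp: A_def space_column_space not_le)
      obtain N where N: "exp (2 * h c) \<le> real N" using real_arch_simple by blast
      have "ennreal (exp (2 * h c)) \<le> ennreal (real N)" using N by (rule ennreal_leI)
      also have "\<dots> = (\<Sum>j<N. 1)" by (simp add: ennreal_of_nat_eq_real_of_nat)
      also have "\<dots> \<le> (\<Sum>j<N. ennreal (t j) * indicator (A j) c)"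
        using inA L(1) by (intro sum_mono) (auto simp: t_def one_le_exp_iff)
      also have "\<dots> \<le> (\<Sum>j. ennreal (t j) * indicator (A j) c)"
        by (intro sum_le_suminf) auto
      finally show ?thesis .
    qed
    then have "(\<integral>\<^sup>+c. ennreal (exp (2 * h c)) \<partial>column_space)
      \<le> (\<integral>\<^sup>+c. (\<Sum>j. ennreal (t j) * indicator (A j) c) \<partial>column_space)"
      by (intro nn_integral_mono)
    also have "\<dots> = (\<Sum>j. \<integral>\<^sup>+c. ennreal (t j) * indicator (A j) c \<partial>column_space)"
      by (intro nn_integral_suminf) measurable
    also have "\<dots> = (\<Sum>j. ennreal (t j) * emeasure column_space (A j))"
      by (simp add: nn_integral_cmult_indicator)
    also have "\<dots> \<le> (\<Sum>j. ennreal (exp (2 * (1 + L)) * (1 / 2) ^ j))"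
    proof (intro suminf_le allI summableI)
      fix j
      have "G.prob {L<..} ^ j \<le> (exp (-4) / 2) ^ j" using L(2) by (intro power_mono) auto
      then have "t j * G.prob {L<..} ^ j \<le> t j * (exp (-4) / 2) ^ j"
        by (intro mult_left_mono) (auto simp: t_def)
      also have "\<dots> = exp (2 * (1 + L)) * (1 / 2) ^ j"
      proof -
        have "t j = exp (2 * (1 + L)) * exp 4 ^ j"
          by (simp add: t_def mult_exp_exp algebra_simps flip: exp_of_nat_mult)
        moreover have "exp (4::real) ^ j * (exp (-4) / 2) ^ j = (1 / 2) ^ j"
          by (simp add: exp_minus_inverse flip: power_mult_distrib)
        ultimately show ?thesis by simp
      qed
      finally show "ennreal (t j) * emeasure column_space (A j) \<le>
        ennreal (exp (2 * (1 + L)) * (1 / 2) ^ j)"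
        unfolding A_def emeasure_all_large
        by (subst ennreal_mult[symmetric]) (auto simp: t_def intro!: ennreal_leI)
    qed
    also have "\<dots> = ennreal (\<Sum>j. exp (2 * (1 + L)) * (1 / 2) ^ j)"
      by (intro suminf_ennreal2) (auto intro!: summable_mult summable_geometric)
    also have "(\<Sum>j. exp (2 * (1 + L)) * (1 / 2) ^ j) = ?K"
      by (subst suminf_mult) (auto simp: suminf_geometric summable_geometric)
    finally show ?thesis .
  qed
  show ?thesis by (rule that[of ?K, OF _ bound]) auto
qed

text \<open>The coordinates are whole columns and the baseline is the free column. Stepping aside,
  with slack 1, bounds the increment by the crossing cost, uniformly in \<open>n\<close> and
  \<open>m\<close>.\<close>

lemma bounded_influence_directed_time:
  obtains K where "K > 0" "\<And>n m. bounded_influence column_space {..<n} (\<lambda>_. 0) K (\<lambda>C. directed_time n C m)"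
proof -
  obtain K where K: "K > 0" "\<And>h y. (\<And>c z. h c \<le> 1 + 2 * \<bar>real_of_int (z - y)\<bar> + max 0 (c z)) \<Longrightarrow>
    (\<integral>\<^sup>+c. ennreal (exp (2 * h c)) \<partial>column_space) \<le> ennreal K"
    using exp_moment_crossing_cost by blast
  have "bounded_influence column_space {..<n} (\<lambda>_. 0) K (\<lambda>C. directed_time n C m)" for n m
    unfolding bounded_influence_def
  proof (intro conjI ballI)
    show "(\<lambda>C. directed_time n C m) \<in> borel_measurable (PiM {..<n} (\<lambda>_. column_space))"
    proof (rule borel_measurable_directed_time)
      fix k z assume "k < n"
      then have "(\<lambda>C. C k) \<in> measurable (PiM {..<n} (\<lambda>_. column_space)) column_space"
        by (intro measurable_component_singleton) auto
      from measurable_compose[OF this borel_measurable_coordinate]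
      show "(\<lambda>C. C k z) \<in> borel_measurable (PiM {..<n} (\<lambda>_. column_space))" .
    qed
  next
    fix k C c
    show "directed_time n (C(k := (\<lambda>_. 0))) m \<le> directed_time n (C(k := c)) m"
      by (rule directed_time_mono) auto
  next
    fix k C assume "k \<in> {..<n}"
    then obtain y where y: "\<And>c z. directed_time n (C(k := c)) m
      \<le> directed_time n (C(k := (\<lambda>_. 0))) m + 1 + 2 * \<bar>real_of_int (z - y)\<bar> + max 0 (c z)"
      using directed_time_update_le[of k n 1 C m] by auto
    show "(\<integral>\<^sup>+c. ennreal (exp (2 * (directed_time n (C(k := c)) m
      - directed_time n (C(k := (\<lambda>_. 0))) m))) \<partial>column_space) \<le> ennreal K"
      by (rule K(2)[of _ y]) (use y in \<open>smt (verit)\<close>)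
  qed
  then show ?thesis using that K(1) by blast
qed

text \<open>Columns are functions of disjoint blocks of independent edge weights, hence independent,
  and each has law \<open>column_space\<close> by reindexing. The criterion for independence asks
  for a nonempty index set, whence \<open>n > 0\<close>.\<close>

lemma distr_columns:
  assumes "n > 0"
  shows "distr (fpp_space G) (PiM {..<n} (\<lambda>_. column_space)) (\<lambda>\<omega>. \<lambda>k\<in>{..<n}. columns \<omega> k)
    = PiM {..<n} (\<lambda>_. column_space)"
proof -
  let ?K = "\<lambda>k. {int k} \<times> (UNIV :: int set)"
  have coord: "distr (fpp_space G) G (\<lambda>\<omega>. \<omega> p) = G" for p
    unfolding fpp_space_def by (rule env.PiM_component) simp
  have "fpp.indep_vars (\<lambda>_. G) (\<lambda>p \<omega>. \<omega> p) UNIV"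
    by (subst fpp.indep_vars_iff_distr_eq_PiM)
      (auto simp: coord, auto simp: fpp_space_def restrict_def distr_id)
  then have "fpp.indep_vars (\<lambda>k. PiM (?K k) (\<lambda>_. G)) (\<lambda>k \<omega>. restrict (\<lambda>p. \<omega> p) (?K k)) {..<n}"
    by (rule fpp.indep_vars_restrict) (auto simp: disjoint_family_on_def)
  then have "fpp.indep_vars (\<lambda>_. column_space)
    (\<lambda>k \<omega>. (\<lambda>\<eta> y. \<eta> (int k, y)) (restrict (\<lambda>p. \<omega> p) (?K k))) {..<n}"
    by (rule fpp.indep_vars_compose2)
      (auto intro!: measurable_PiM_single' measurable_component_singleton simp: space_G space_PiM)
  then have indep: "fpp.indep_vars (\<lambda>_. column_space) (\<lambda>k \<omega>. columns \<omega> k) {..<n}"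
    by (simp add: columns_def[abs_def])
  have col: "distr (fpp_space G) column_space (\<lambda>\<omega>. columns \<omega> k) = column_space" for k
    using distr_PiM_reindex[of UNIV "\<lambda>_. G" "\<lambda>y. (int k, y)" UNIV] prob_G
    by (simp add: fpp_space_def columns_def[abs_def] inj_on_def restrict_def)
  have meas: "(\<lambda>\<omega>. columns \<omega> k) \<in> measurable (fpp_space G) column_space" for k
    using indep assms unfolding columns_def[abs_def]
    by (auto intro!: measurable_PiM_single' simp: fpp_space_def space_PiM space_G)
  show ?thesis
    using iffD1[OF fpp.indep_vars_iff_distr_eq_PiM'[where M'="\<lambda>_. column_space"] indep]
    assms meas by (auto simp: col)
qed

section \<open>Exponential moments and concentration around the mean\<close>

definition mean_time :: "nat \<Rightarrow> int \<Rightarrow> real" where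
  "mean_time n m = (\<integral>\<omega>. directed_time n (columns \<omega>) m \<partial>fpp_space G)"

text \<open>Transfers the product-space bounds to \<open>fpp_space\<close>:
  \<open>directed_time n\<close> sees the first \<open>n\<close> columns only.\<close>

lemma directed_time_moments:
  "\<exists>K>0. \<forall>n>0. \<forall>m. integrable (fpp_space G) (\<lambda>\<omega>. directed_time n (columns \<omega>) m) \<and>
    (\<forall>\<theta>. \<bar>\<theta>\<bar> \<le> 1 \<longrightarrow>
      (\<integral>\<^sup>+\<omega>. ennreal (exp (\<theta> * directed_time n (columns \<omega>) m)) \<partial>fpp_space G)
        \<le> ennreal (exp (\<theta> * mean_time n m + real n * K * \<theta>\<^sup>2)))"
proof -
  obtain K where K: "K > 0" 
    "\<And>n m. bounded_influence column_space {..<n} (\<lambda>_. 0) K (\<lambda>C. directed_time n C m)"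
    using bounded_influence_directed_time by blast
  have b: "(\<lambda>_. 0) \<in> space column_space" by (simp add: space_column_space)
  have *: "integrable (fpp_space G) (\<lambda>\<omega>. directed_time n (columns \<omega>) m) \<and>
    (\<bar>\<theta>\<bar> \<le> 1 \<longrightarrow> (\<integral>\<^sup>+\<omega>. ennreal (exp (\<theta> * directed_time n (columns \<omega>) m)) \<partial>fpp_space G)
        \<le> ennreal (exp (\<theta> * mean_time n m + real n * K * \<theta>\<^sup>2)))" if n: "n > 0" for n m \<theta>
  proof -
    let ?P = "PiM {..<n} (\<lambda>_. column_space)"
    let ?r = "\<lambda>\<omega>. \<lambda>k\<in>{..<n}. columns \<omega> k"
    have r: "?r \<in> measurable (fpp_space G) ?P"
      unfolding columns_def[abs_def]
      by (auto intro!: measurable_restrict measurable_PiM_single' simp: fpp_space_def space_PiM space_G)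
    have f [measurable]: "(\<lambda>C. directed_time n C m) \<in> borel_measurable ?P"
      using K(2)[of n m] by (simp add: bounded_influence_def)
    have eq: "directed_time n (?r \<omega>) m = directed_time n (columns \<omega>) m" for \<omega>
      by (rule directed_time_cong) auto
    have int: "integrable ?P (\<lambda>C. directed_time n C m)"
      by (rule bounded_influence_integrable[OF _ b _ K(2)]) (auto intro: prob_space_PiM prob_G)
    have "integrable (distr (fpp_space G) ?P ?r) (\<lambda>C. directed_time n C m)"
      using int by (simp only: distr_columns[OF n])
    then have i: "integrable (fpp_space G) (\<lambda>\<omega>. directed_time n (columns \<omega>) m)"
      by (simp only: integrable_distr_eq[OF r f] eq)
    have mean: "(\<integral>C. directed_time n C m \<partial>?P) = mean_time n m"
      using integral_distr[OF r f] by (simp only: distr_columns[OF n] eq mean_time_def)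
    have m2: "(\<lambda>C. ennreal (exp (\<theta> * directed_time n C m)))
      \<in> borel_measurable (distr (fpp_space G) ?P ?r)" by measurable
    have "(\<integral>\<^sup>+\<omega>. ennreal (exp (\<theta> * directed_time n (columns \<omega>) m)) \<partial>fpp_space G) =
      (\<integral>\<^sup>+C. ennreal (exp (\<theta> * directed_time n C m)) \<partial>?P)"
      using nn_integral_distr[OF r m2] by (simp only: distr_columns[OF n] eq)
    also have "\<bar>\<theta>\<bar> \<le> 1 \<Longrightarrow> \<dots> \<le> ennreal (exp (\<theta> * mean_time n m + real n * K * \<theta>\<^sup>2))"
      using bounded_influence_exp_moment[OF _ b _ K(2)[of n m], of \<theta>]
      by (simp add: prob_space_PiM prob_G mean)
    finally show ?thesis using i by blast
  qed
  then show ?thesis using K(1) by blast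
qed

lemma integrable_directed_time:
  "n > 0 \<Longrightarrow> integrable (fpp_space G) (\<lambda>\<omega>. directed_time n (columns \<omega>) m)"
  using directed_time_moments by blast

text \<open>Chernoff's method: the exponent is \<open>n * \<theta> * (K * \<theta> - t)\<close>,
  uniformly in the target row.\<close>

lemma directed_time_concentration:
  assumes "t > 0"
  shows "\<exists>B>0. \<forall>n>0. \<forall>m.
    fpp.prob {\<omega> \<in> space (fpp_space G).
      mean_time n m + real n * t \<le> directed_time n (columns \<omega>) m} \<le> exp (- B * real n) \<and>
    fpp.prob {\<omega> \<in> space (fpp_space G).
      directed_time n (columns \<omega>) m \<le> mean_time n m - real n * t} \<le> exp (- B * real n)"
proof -
  obtain K where K: "K > 0" "\<forall>n>0. \<forall>m.
    integrable (fpp_space G) (\<lambda>\<omega>. directed_time n (columns \<omega>) m) \<and>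
    (\<forall>\<theta>. \<bar>\<theta>\<bar> \<le> 1 \<longrightarrow>
      (\<integral>\<^sup>+\<omega>. ennreal (exp (\<theta> * directed_time n (columns \<omega>) m)) \<partial>fpp_space G)
        \<le> ennreal (exp (\<theta> * mean_time n m + real n * K * \<theta>\<^sup>2)))"
    using directed_time_moments by blast
  \<comment> \<open>Capped at 1 for the moment bound, and small enough that the quadratic term
    consumes at most half of \<open>t\<close>.\<close>
  define \<theta> where "\<theta> = min 1 (t / (2 * K))"
  have \<theta>: "0 < \<theta>" "\<theta> \<le> 1" "K * \<theta> \<le> t / 2"
  proof -
    have "K * \<theta> \<le> K * (t / (2 * K))" using K(1) by (intro mult_left_mono) (auto simp: \<theta>_def)
    then show "K * \<theta> \<le> t / 2" using K(1) by simp
  qed (use assms K(1) in \<open>auto simp: \<theta>_def\<close>)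
  \<comment> \<open>The sign \<open>s\<close> is 1 for the upper and -1 for the lower tail.\<close>
  have tail: "fpp.prob {\<omega> \<in> space (fpp_space G). s * mean_time n m + real n * t
      \<le> s * directed_time n (columns \<omega>) m} \<le> exp (- (\<theta> * t / 2) * real n)"
    if n: "n > 0" and s: "\<bar>s\<bar> = 1" for n m s
  proof -
    note [measurable] = borel_measurable_directed_time_columns
    let ?X = "\<lambda>\<omega>. directed_time n (columns \<omega>) m"
    let ?c = "\<theta> * (s * mean_time n m + real n * t)"
    have "{\<omega> \<in> space (fpp_space G). s * mean_time n m + real n * t \<le> s * ?X \<omega>}
      = {\<omega> \<in> space (fpp_space G). 1 \<le> ennreal (exp (- ?c)) * ennreal (exp ((s * \<theta>) * ?X \<omega>))}"
    proof -
      have "a \<le> s * x \<longleftrightarrow> 1 \<le> ennreal (exp (- (\<theta> * a))) * ennreal (exp ((s * \<theta>) * x))" for a x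
      proof -
        have "ennreal (exp (- (\<theta> * a))) * ennreal (exp ((s * \<theta>) * x)) = ennreal (exp (\<theta> * (s * x - a)))"
          by (simp add: mult_exp_exp algebra_simps flip: ennreal_mult)
        then show ?thesis using \<theta>(1) by (simp add: ennreal_1[symmetric] zero_le_mult_iff del: ennreal_1)
      qed
      then show ?thesis by auto
    qed
    also have "emeasure (fpp_space G) \<dots> \<le> ennreal (exp (- ?c)) *
      (\<integral>\<^sup>+\<omega>. ennreal (exp ((s * \<theta>) * ?X \<omega>)) * indicator (space (fpp_space G)) \<omega> \<partial>fpp_space G)"
      by (rule nn_integral_Markov_inequality) auto
    also have "\<dots> = ennreal (exp (- ?c)) * (\<integral>\<^sup>+\<omega>. ennreal (exp ((s * \<theta>) * ?X \<omega>)) \<partial>fpp_space G)"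
      by (simp add: space_fpp_space)
    also have "\<dots> \<le> ennreal (exp (- ?c)) * ennreal (exp (s * \<theta> * mean_time n m + real n * K * (s * \<theta>)\<^sup>2))"
      using \<theta>(1,2) s n K(2) by (intro mult_left_mono) (auto simp: abs_mult)
    also have "\<dots> = ennreal (exp (real n * \<theta> * (K * \<theta> - t)))"
    proof -
      have "s\<^sup>2 = 1" using s by (metis abs_1 power2_abs one_power2)
      then have "- ?c + (s * \<theta> * mean_time n m + real n * K * (s * \<theta>)\<^sup>2) = real n * \<theta> * (K * \<theta> - t)"
        by (simp add: power_mult_distrib power2_eq_square[of \<theta>] algebra_simps)
      then show ?thesis by (simp add: mult_exp_exp flip: ennreal_mult)
    qed
    also have "\<dots> \<le> ennreal (exp (- (\<theta> * t / 2) * real n))"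
    proof -
      have "real n * \<theta> * (K * \<theta> - t) \<le> real n * \<theta> * (- t / 2)"
        using \<theta> by (intro mult_left_mono) auto
      then show ?thesis by (intro ennreal_leI) (simp add: algebra_simps)
    qed
    finally show ?thesis by (simp add: fpp.emeasure_eq_measure)
  qed
  have "fpp.prob {\<omega> \<in> space (fpp_space G). directed_time n (columns \<omega>) m \<le> mean_time n m - real n * t}
    \<le> exp (- (\<theta> * t / 2) * real n)" if "n > 0" for n m
  proof -
    have "(directed_time n (columns \<omega>) m \<le> mean_time n m - real n * t) \<longleftrightarrow>
      (-1 * mean_time n m + real n * t \<le> -1 * directed_time n (columns \<omega>) m)" for \<omega> by auto
    then show ?thesis using tail[OF that, of "-1" m] by simp
  qed
  moreover have "fpp.prob {\<omega> \<in> space (fpp_space G). mean_time n m + real n * t \<le> directed_time n (columns \<omega>) m}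
    \<le> exp (- (\<theta> * t / 2) * real n)" if "n > 0" for n m
    using tail[OF that, of 1 m] by simp
  ultimately show ?thesis using \<theta>(1) assms by (intro exI[of _ "\<theta> * t / 2"]) simp
qed


section \<open>Stationarity and the limiting slope of the mean\<close>

lemma distr_shift:
  "distr (fpp_space G) (fpp_space G) (\<lambda>\<omega> p. \<omega> (fst p + a, snd p + b)) = fpp_space G"
  using distr_PiM_reindex[of UNIV "\<lambda>_. G" "\<lambda>p. (fst p + a, snd p + b)" UNIV] prob_G
  by (simp add: fpp_space_def inj_on_def prod_eq_iff restrict_def)

lemma measurable_shift:
  "(\<lambda>\<omega> p. \<omega> (fst p + a, snd p + b)) \<in> measurable (fpp_space G) (fpp_space G)"
  unfolding fpp_space_def by (auto intro!: measurable_PiM_single' simp: space_PiM space_G)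

lemma mean_time_nonneg: "0 \<le> mean_time n m"
  unfolding mean_time_def by (simp add: directed_time_nonneg)

lemma mean_time_lipschitz:
  assumes "n > 0"
  shows "mean_time n m \<le> mean_time n m' + \<bar>real_of_int (m - m')\<bar>"
proof -
  have "mean_time n m \<le> (\<integral>\<omega>. directed_time n (columns \<omega>) m' + \<bar>real_of_int (m - m')\<bar> \<partial>fpp_space G)"
    unfolding mean_time_def
    by (intro integral_mono directed_time_lipschitz Bochner_Integration.integrable_add
        integrable_directed_time assms) auto
  then show ?thesis
    unfolding mean_time_def using integrable_directed_time[OF assms] by (simp add: fpp.prob_space)
qed

text \<open>Integrates the pathwise inequality; the shifted environment has the same law.\<close>

lemma mean_time_subadditive:
  assumes "n > 0" "k > 0"
  shows "mean_time (n + k) (m + l) \<le> mean_time n m + mean_time k l"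
proof -
  let ?s = "\<lambda>\<omega> p. \<omega> (fst p + int n, snd p + m) :: real"
  note meas = borel_measurable_directed_time_columns[of k l]
  have int: "integrable (fpp_space G) (\<lambda>\<omega>. directed_time k (columns (?s \<omega>)) l)"
    using integrable_directed_time[OF assms(2), of l]
      integrable_distr_eq[OF measurable_shift[of "int n" m] meas] by (simp only: distr_shift)
  have eq: "(\<integral>\<omega>. directed_time k (columns (?s \<omega>)) l \<partial>fpp_space G) = mean_time k l"
    using integral_distr[OF measurable_shift[of "int n" m] meas] by (simp only: distr_shift mean_time_def)
  have "mean_time (n + k) (m + l) \<le>
    (\<integral>\<omega>. directed_time n (columns \<omega>) m + directed_time k (columns (?s \<omega>)) l \<partial>fpp_space G)"
    unfolding mean_time_def using assms int
    by (intro integral_mono directed_time_subadditive Bochner_Integration.integrable_add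
        integrable_directed_time) auto
  also have "\<dots> = mean_time n m + mean_time k l"
    using int assms by (simp add: integrable_directed_time eq) (simp add: mean_time_def)
  finally show ?thesis .
qed

definition limit_mean :: "real \<Rightarrow> real" where
  "limit_mean v = lim (\<lambda>n. mean_time n \<lceil>v * real n\<rceil> / real n)"

text \<open>Ceilings are additive only up to 1. By the Lipschitz bound this costs at most 1, which
  the summand 1 in \<open>u\<close> absorbs.\<close>

lemma mean_time_tendsto:
  "(\<lambda>n. mean_time n \<lceil>v * real n\<rceil> / real n) \<longlonglongrightarrow> limit_mean v"
proof -
  define u where "u n = mean_time n \<lceil>v * real n\<rceil> + 1" for n
  have "convergent (\<lambda>n. u n / real n)"
  proof (rule fekete)
    fix m n :: nat assume mn: "m > 0" "n > 0"
    let ?c = "\<lceil>v * real m\<rceil> + \<lceil>v * real n\<rceil>"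
    have "v * real (m + n) = v * real m + v * real n" by (simp add: algebra_simps)
    then have "\<bar>\<lceil>v * real (m + n)\<rceil> - ?c\<bar> \<le> 1" by linarith
    then have "\<bar>real_of_int (\<lceil>v * real (m + n)\<rceil> - ?c)\<bar> \<le> 1" by linarith
    then have "mean_time (m + n) \<lceil>v * real (m + n)\<rceil> \<le> mean_time (m + n) ?c + 1"
      using mean_time_lipschitz[of "m + n" "\<lceil>v * real (m + n)\<rceil>" ?c] mn by (smt (verit) add_pos_pos)
    then show "u (m + n) \<le> u m + u n"
      using mean_time_subadditive[OF mn, of "\<lceil>v * real m\<rceil>" "\<lceil>v * real n\<rceil>"] by (simp add: u_def)
  next
    show "0 \<le> u n" for n using mean_time_nonneg by (simp add: u_def)
  qed
  then have "convergent (\<lambda>n. u n / real n - 1 / real n)"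
    by (intro convergent_diff convergentI[OF lim_const_over_n])
  then have "convergent (\<lambda>n. mean_time n \<lceil>v * real n\<rceil> / real n)"
    by (simp add: u_def diff_divide_distrib[symmetric])
  then show ?thesis unfolding limit_mean_def by (simp add: convergent_LIMSEQ_iff)
qed

lemma mean_time_slope_lipschitz:
  assumes "n > 0"
  shows "mean_time n \<lceil>v * real n\<rceil> / real n \<le> mean_time n \<lceil>w * real n\<rceil> / real n + \<bar>v - w\<bar> + 1 / real n"
proof -
  have "\<bar>v * real n - w * real n\<bar> = \<bar>v - w\<bar> * real n"
    by (simp add: abs_mult flip: left_diff_distrib)
  then have "\<bar>real_of_int (\<lceil>v * real n\<rceil> - \<lceil>w * real n\<rceil>)\<bar> \<le> \<bar>v - w\<bar> * real n + 1" by linarith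
  then have "mean_time n \<lceil>v * real n\<rceil> \<le> mean_time n \<lceil>w * real n\<rceil> + (\<bar>v - w\<bar> * real n + 1)"
    using mean_time_lipschitz[OF assms, of "\<lceil>v * real n\<rceil>" "\<lceil>w * real n\<rceil>"] by linarith
  then have "mean_time n \<lceil>v * real n\<rceil> / real n
    \<le> (mean_time n \<lceil>w * real n\<rceil> + (\<bar>v - w\<bar> * real n + 1)) / real n"
    by (intro divide_right_mono) auto
  then show ?thesis using assms by (simp add: add_divide_distrib add.assoc)
qed

lemma limit_mean_lipschitz: "limit_mean v \<le> limit_mean w + \<bar>v - w\<bar>"
proof -
  have "(\<lambda>n. mean_time n \<lceil>w * real n\<rceil> / real n + \<bar>v - w\<bar> + 1 / real n) \<longlonglongrightarrow> limit_mean w + \<bar>v - w\<bar> + 0"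
    by (intro tendsto_add mean_time_tendsto tendsto_const lim_const_over_n)
  moreover have "\<exists>N. \<forall>n\<ge>N. mean_time n \<lceil>v * real n\<rceil> / real n
    \<le> mean_time n \<lceil>w * real n\<rceil> / real n + \<bar>v - w\<bar> + 1 / real n"
    by (intro exI[of _ 1] allI impI mean_time_slope_lipschitz) simp
  ultimately show ?thesis using LIMSEQ_le[OF mean_time_tendsto[of v]] by simp
qed

text \<open>A finite net of mesh \<open>\<epsilon> / 4\<close>. The four quarters pay for
  convergence at the net point, moving the slope of the mean, rounding by \<open>1 / n\<close>, and
  moving the limit.\<close>

lemma mean_time_uniform:
  assumes "\<epsilon> > 0"
  shows "\<forall>\<^sub>F n in sequentially. \<forall>v\<in>{0..v\<^sub>0}. mean_time n \<lceil>v * real n\<rceil> \<le> real n * (limit_mean v + \<epsilon>)"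
proof -
  let ?e = "\<epsilon> / 4"
  have "?e > 0" using assms by simp
  then obtain F where F: "finite F" "{0..v\<^sub>0} \<subseteq> (\<Union>w\<in>F. ball w ?e)"
    using compact_Icc[of 0 v\<^sub>0] unfolding compact_eq_totally_bounded by meson
  have "\<forall>\<^sub>F n in sequentially. \<forall>w\<in>F. mean_time n \<lceil>w * real n\<rceil> / real n < limit_mean w + ?e"
    using F(1) \<open>?e > 0\<close>
    by (intro eventually_ball_finite ballI order_tendstoD(2)[OF mean_time_tendsto]) auto
  moreover have "\<forall>\<^sub>F n in sequentially. 1 / real n < ?e"
    using \<open>?e > 0\<close> by (rule order_tendstoD(2)[OF lim_const_over_n])
  ultimately show ?thesis using eventually_gt_at_top[of 0]
  proof eventually_elim
    case (elim n)
    show ?case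
    proof
      fix v assume "v \<in> {0..v\<^sub>0}"
      then obtain w where w: "w \<in> F" "\<bar>v - w\<bar> < ?e"
        using F(2) by (auto simp: dist_real_def abs_minus_commute)
      have "mean_time n \<lceil>v * real n\<rceil> / real n \<le> limit_mean v + \<epsilon>"
        using elim(1)[rule_format, OF w(1)] elim(2) w(2) mean_time_slope_lipschitz[OF elim(3), of v w]
          limit_mean_lipschitz[of w v] by (simp add: abs_minus_commute)
      then show "mean_time n \<lceil>v * real n\<rceil> \<le> real n * (limit_mean v + \<epsilon>)"
        using elim(3) by (simp add: field_simps)
    qed
  qed
qed

section \<open>Almost sure convergence\<close>

lemma directed_time_near_mean:
  assumes "t > 0"
  shows "AE \<omega> in fpp_space G. \<forall>\<^sub>F n in sequentially.
    \<bar>directed_time n (columns \<omega>) (m n) / real n - mean_time n (m n) / real n\<bar> < t"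
proof -
  note [measurable] = borel_measurable_directed_time_columns
  obtain B where B: "B > 0" "\<forall>n>0. \<forall>m.
    fpp.prob {\<omega> \<in> space (fpp_space G).
      mean_time n m + real n * t \<le> directed_time n (columns \<omega>) m} \<le> exp (- B * real n) \<and>
    fpp.prob {\<omega> \<in> space (fpp_space G).
      directed_time n (columns \<omega>) m \<le> mean_time n m - real n * t} \<le> exp (- B * real n)"
    using directed_time_concentration[OF assms] by blast
  define U where "U n = {\<omega> \<in> space (fpp_space G).
      mean_time n (m n) + real n * t \<le> directed_time n (columns \<omega>) (m n)}" for n
  define D where "D n = {\<omega> \<in> space (fpp_space G).
      directed_time n (columns \<omega>) (m n) \<le> mean_time n (m n) - real n * t}" for n
  have [measurable]: "U n \<in> sets (fpp_space G)" "D n \<in> sets (fpp_space G)" for n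
    unfolding U_def D_def by measurable
  have "summable (\<lambda>n. fpp.prob (U n \<union> D n))"
  proof (rule summable_comparison_test')
    show "summable (\<lambda>n. 2 * exp (- B) ^ n)"
      using B(1) by (intro summable_mult summable_geometric) auto
    show "norm (fpp.prob (U n \<union> D n)) \<le> 2 * exp (- B) ^ n" if "n \<ge> 1" for n
    proof -
      have "fpp.prob (U n \<union> D n) \<le> fpp.prob (U n) + fpp.prob (D n)"
        by (intro measure_Un_le) auto
      also have "\<dots> \<le> exp (- B * real n) + exp (- B * real n)"
        using B(2) that unfolding U_def D_def by (intro add_mono) auto
      also have "exp (- B * real n) = exp (- B) ^ n"
        using exp_of_nat2_mult[of "- B" n] by simp
      finally show ?thesis by simp
    qed
  qed
  then have "AE \<omega> in fpp_space G. \<forall>\<^sub>F n in sequentially. \<omega> \<in> space (fpp_space G) - (U n \<union> D n)"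
    by (intro borel_cantelli_AE1) (auto simp: fpp.emeasure_eq_measure)
  then show ?thesis
  proof eventually_elim
    case (elim \<omega>)
    then show ?case using eventually_gt_at_top[of 0]
    proof eventually_elim
      case (elim n)
      then have "\<bar>directed_time n (columns \<omega>) (m n) - mean_time n (m n)\<bar> < real n * t"
        by (auto simp: U_def D_def)
      then show ?case using elim(2)
        by (simp add: field_simps flip: diff_divide_distrib)
    qed
  qed
qed

text \<open>Countably many thresholds \<open>1 / Suc j\<close> give a single null set.\<close>

lemma directed_time_tendsto:
  "AE \<omega> in fpp_space G.
    (\<lambda>n. directed_time n (columns \<omega>) \<lceil>v * real n\<rceil> / real n) \<longlonglongrightarrow> limit_mean v"
proof -
  have "AE \<omega> in fpp_space G. \<forall>j::nat. \<forall>\<^sub>F n in sequentially.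
    \<bar>directed_time n (columns \<omega>) \<lceil>v * real n\<rceil> / real n - mean_time n \<lceil>v * real n\<rceil> / real n\<bar>
      < 1 / real (Suc j)"
    unfolding AE_all_countable by (intro allI directed_time_near_mean) simp
  then show ?thesis
  proof eventually_elim
    case (elim \<omega>)
    let ?d = "\<lambda>n. directed_time n (columns \<omega>) \<lceil>v * real n\<rceil> / real n - mean_time n \<lceil>v * real n\<rceil> / real n"
    have "?d \<longlonglongrightarrow> 0"
    proof (rule tendstoI)
      fix e :: real assume "e > 0"
      then obtain j where "1 / real (Suc j) < e" using nat_approx_posE by metis
      with elim[rule_format, of j] show "\<forall>\<^sub>F n in sequentially. dist (?d n) 0 < e"
        by (auto elim!: eventually_mono simp: dist_real_def)
    qed
    from tendsto_add[OF this mean_time_tendsto[of v]] show ?case by simp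
  qed
qed

section \<open>Nonnegative weights: the time constant and the tail bound\<close>

context
  assumes nonneg_G: "AE x in G. 0 \<le> x"
begin

lemma AE_passage_time_eq:
  "AE \<omega> in fpp_space G. \<forall>n m. passage_time \<omega> (0, 0) (int n, m) = directed_time n (columns \<omega>) m"
proof -
  have "AE \<omega> in fpp_space G. \<forall>p. 0 \<le> \<omega> p"
    unfolding AE_all_countable fpp_space_def
    using nonneg_G by (intro allI env.AE_component) auto
  then show ?thesis by eventually_elim (intro allI passage_time_eq_directed_time, blast)
qed

text \<open>Justifies the definite description: \<open>limit_mean v\<close> is an almost sure limit,
  and two such constants agree on a set of probability 1, hence agree.\<close>

lemma time_const_eq: "time_const G v = limit_mean v"
  unfolding time_const_def
proof (rule the_equality)
  have *: "AE \<omega> in fpp_space G.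
    (\<lambda>n. passage_time \<omega> (0,0) (int n, \<lceil>v * real n\<rceil>) / real n) \<longlonglongrightarrow> limit_mean v"
    using AE_passage_time_eq directed_time_tendsto[of v] by eventually_elim simp
  then show "AE \<omega> in fpp_space G.
    (\<lambda>n. passage_time \<omega> (0,0) (int n, \<lceil>v * real n\<rceil>) / real n) \<longlonglongrightarrow> limit_mean v" .
  fix l
  assume "AE \<omega> in fpp_space G.
    (\<lambda>n. passage_time \<omega> (0,0) (int n, \<lceil>v * real n\<rceil>) / real n) \<longlonglongrightarrow> l"
  with * have "AE \<omega> in fpp_space G. l = limit_mean v"
    by eventually_elim (rule LIMSEQ_unique)
  then show "l = limit_mean v" by simp
qed

text \<open>Half of \<open>\<epsilon>\<close> covers the distance from mean to limit, uniformly in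
  \<open>v\<close> for \<open>n \<ge> N\<close>, and half the fluctuation. The prefactor
  \<open>exp (B * real N)\<close> makes the bound trivial for smaller \<open>n\<close>.\<close>

lemma passage_time_upper_tail:
  assumes "\<epsilon> > 0"
  shows "\<exists>A B. A > 0 \<and> B > 0 \<and> (\<forall>n::nat. n \<ge> 1 \<longrightarrow> (\<forall>v\<in>{0..v\<^sub>0}.
    fpp.prob {\<omega> \<in> space (fpp_space G).
      passage_time \<omega> (0,0) (int n, \<lceil>v * real n\<rceil>) \<ge> real n * (time_const G v + \<epsilon>)}
    \<le> A * exp (- B * real n)))"
proof -
  note [measurable] = borel_measurable_directed_time_columns
  have e: "\<epsilon> / 2 > 0" using assms by simp
  obtain B where B: "B > 0" "\<forall>n>0. \<forall>m.
    fpp.prob {\<omega> \<in> space (fpp_space G).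
      mean_time n m + real n * (\<epsilon> / 2) \<le> directed_time n (columns \<omega>) m} \<le> exp (- B * real n) \<and>
    fpp.prob {\<omega> \<in> space (fpp_space G).
      directed_time n (columns \<omega>) m \<le> mean_time n m - real n * (\<epsilon> / 2)} \<le> exp (- B * real n)"
    using directed_time_concentration[OF e] by blast
  obtain N where N: "\<And>n v. n \<ge> N \<Longrightarrow> v \<in> {0..v\<^sub>0} \<Longrightarrow>
    mean_time n \<lceil>v * real n\<rceil> \<le> real n * (limit_mean v + \<epsilon> / 2)"
    using mean_time_uniform[OF e, of v\<^sub>0] unfolding eventually_sequentially by blast
  have "fpp.prob {\<omega> \<in> space (fpp_space G).
      passage_time \<omega> (0,0) (int n, \<lceil>v * real n\<rceil>) \<ge> real n * (time_const G v + \<epsilon>)}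
    \<le> exp (B * real N) * exp (- B * real n)" (is "fpp.prob ?S \<le> _")
    if n: "n \<ge> 1" and v: "v \<in> {0..v\<^sub>0}" for n v
  proof (cases "n \<ge> N")
    case True
    let ?S' = "{\<omega> \<in> space (fpp_space G). mean_time n \<lceil>v * real n\<rceil> + real n * (\<epsilon> / 2)
      \<le> directed_time n (columns \<omega>) \<lceil>v * real n\<rceil>}"
    \<comment> \<open>Almost sure inclusion suffices, with measurability checked for
      \<open>?S'\<close>, which is stated through \<open>directed_time\<close>.\<close>
    have "AE \<omega> in fpp_space G. \<omega> \<in> ?S \<longrightarrow> \<omega> \<in> ?S'"
      using AE_passage_time_eq
    proof eventually_elim
      case (elim \<omega>)
      then show ?case
        using N[OF True v] by (auto simp: time_const_eq algebra_simps)
    qed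
    then have "fpp.prob ?S \<le> fpp.prob ?S'"
      by (rule fpp.finite_measure_mono_AE) measurable
    also have "\<dots> \<le> exp (- B * real n)" using B(2) n by auto
    also have "\<dots> \<le> exp (B * real N) * exp (- B * real n)"
      using B(1) by (simp add: mult_exp_exp)
    finally show ?thesis .
  next
    case False
    have "fpp.prob ?S \<le> 1" by (rule fpp.prob_le_1)
    also have "1 \<le> exp (B * real N) * exp (- B * real n)"
      using B(1) False by (simp add: mult_exp_exp)
    finally show ?thesis .
  qed
  then show ?thesis using B(1)
    by (intro exI[of _ "exp (B * real N)"] exI[of _ B]) auto
qed

end

end

theorem theorem3p7:
  fixes G :: "real measure" and \<epsilon> v\<^sub>0 :: real
  assumes "prob_space G" and "sets G = sets borel" and "AE x in G. 0 \<le> x"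
    and "\<epsilon> > 0" and "v\<^sub>0 \<ge> 0"
  shows "\<exists>A B. A > 0 \<and> B > 0 \<and>
    (\<forall>n::nat. n \<ge> 1 \<longrightarrow> (\<forall>v \<in> {0..v\<^sub>0}.
      measure (fpp_space G)
        {\<omega> \<in> space (fpp_space G).
           passage_time \<omega> (0,0) (int n, \<lceil>v * real n\<rceil>) \<ge> real n * (time_const G v + \<epsilon>)}
      \<le> A * exp (- B * real n)))"
  using passage_time_upper_tail[OF assms(1-4)] .

end
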